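(* Let $G$ and $H$ be locally compact abelian Polish groups. If $E(G)\leq_B E(H)$, then there is a continuous homomorphism $S:G_0\to H_0$ such that $\ker(S)$ is non-archimedean.
   Context: For a Polish group $G$, $E(G)$ is the equivalence relation on $G^\omega$ given by $x\,E(G)\,y$ iff the sequence $(x(n)y(n)^{-1})_{n}$ converges in $G$. For equivalence relations $E,F$ on Polish spaces $X,Y$, $E\leq_B F$ means there is a Borel map $\theta:X\to Y$ with $x E y\iff \theta(x) F \theta(y)$ for all $x,y\in X$. For a topological group $G$, $G_0$ denotes the connected component of the identity. A Polish group is non-archimedean if it has a neighborhood base of the identity consisting of open subgroups. *)

theory Defs
  imports "HOL-Analysis.Analysis"
begin

text \<open>
  Groups are written additively, so \<open>x n - y n\<close> stands for \<open>x(n) y(n)\<^sup>-\<^sup>1\<close>; the class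
  \<open>topological_group_add\<close> does not assume commutativity. A Polish group is a type of sort
  \<open>{polish_space, topological_group_add}\<close>: that class carries a complete metric, but
  everything below depends only on the topology it induces. The space \<open>nat \<Rightarrow> 'a\<close> has the
  product topology.
\<close>

definition E_rel ::
  "(nat \<Rightarrow> 'a::{polish_space, topological_group_add}) \<Rightarrow> (nat \<Rightarrow> 'a) \<Rightarrow> bool" where
  "E_rel x y \<longleftrightarrow> convergent (\<lambda>n. x n - y n)"

definition borel_reducible ::
  "('x::polish_space \<Rightarrow> 'x \<Rightarrow> bool) \<Rightarrow> ('y::polish_space \<Rightarrow> 'y \<Rightarrow> bool) \<Rightarrow> bool"
  (infix \<open>\<le>\<^sub>B\<close> 50) where
  "E \<le>\<^sub>B F \<longleftrightarrow> (\<exists>\<theta> \<in> borel_measurable borel. \<forall>x y. E x y \<longleftrightarrow> F (\<theta> x) (\<theta> y))"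

definition identity_component :: "'a::topological_group_add set" where
  "identity_component = connected_component_set UNIV 0"

definition is_subgroup :: "'a::group_add set \<Rightarrow> bool" where
  "is_subgroup K \<longleftrightarrow> 0 \<in> K \<and> (\<forall>x\<in>K. \<forall>y\<in>K. x + y \<in> K) \<and> (\<forall>x\<in>K. - x \<in> K)"

definition hom_on ::
  "'a::group_add set \<Rightarrow> 'b::group_add set \<Rightarrow> ('a \<Rightarrow> 'b) \<Rightarrow> bool" where
  "hom_on K L S \<longleftrightarrow> S \<in> K \<rightarrow> L \<and> (\<forall>x\<in>K. \<forall>y\<in>K. S (x + y) = S x + S y)"

definition ker_on :: "'a::group_add set \<Rightarrow> ('a \<Rightarrow> 'b::group_add) \<Rightarrow> 'a set" where
  "ker_on K S = {x \<in> K. S x = 0}"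

text \<open>
  To be applied to a subgroup \<open>K\<close> of the ambient group, regarded as a topological group in
  its own right: openness is relative to \<open>K\<close>.
\<close>

definition non_archimedean :: "'a::topological_group_add set \<Rightarrow> bool" where
  "non_archimedean K \<longleftrightarrow>
     (\<forall>U. openin (top_of_set K) U \<and> 0 \<in> U \<longrightarrow>
        (\<exists>V. openin (top_of_set K) V \<and> is_subgroup V \<and> V \<subseteq> U))"

end

theory Submission
  imports Defs
begin

text \<open>
  Restrict a Borel reduction \<open>\<theta>\<close> to a generic point \<open>z\<close> shifted by sequences that jump, at sparse times \<open>n\<close>,
  between elements of a countable dense subgroup \<open>D\<close> of the identity component. A jump by \<open>g\<close> at time \<open>n\<close>
  changes \<open>\<theta> z\<close> by a sequence converging to some \<open>\<Lambda> [(n, g)]\<close> in the second group, and if the jump times are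
  sparse enough the effects of successive jumps add up. So for suitable \<open>n\<^sub>k\<close> the series \<open>a\<^sub>k - b\<^sub>k\<close> converges iff
  the series \<open>\<Lambda> [(n\<^sub>k, a\<^sub>k)] - \<Lambda> [(n\<^sub>k, b\<^sub>k)]\<close> does and the transient effects vanish uniformly. This makes the
  maps \<open>\<Lambda> [(n, _)]\<close> equicontinuous, so by local compactness a subsequence converges to a map \<open>S\<close> on \<open>D\<close>.
  Walks with small steps, available by connectedness, show that \<open>S\<close> is additive; and if the kernel of its
  extension were not non-archimedean, it would contain arbitrarily fine walks leaving a fixed neighbourhood of 0,
  giving a divergent series that the reduction sends to a convergent one.
\<close>

section \<open>Group norms on locally compact abelian groups\<close>

text \<open>The reduction is merely Borel and ignores the group structure: its response to a jump
  depends on the base point and on the time, and it is tame only on a comeager set. Baire category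
  meets countably many demands at once, which is why jumps are taken from a countable
  \<open>D\<close>. Convergence of the difference of two images is moreover more than convergence of
  the limits \<open>\<Lambda>\<close>: between two jumps it may make an excursion and return. These
  transients form the second half of the criterion and must be controlled whenever convergence is
  pulled back to the first group. Two sequences \<open>a\<close> and \<open>b\<close> are compared,
  rather than one with 0, because additivity concerns increments taken at different base points.
  Local compactness enters twice: it makes Cauchy sequences for an invariant norm converge, and it
  supplies the compact sets behind the limit map. The metrics of the types need not be translation
  invariant, so all estimates use norms \<open>N\<close> instead.\<close>

locale group_norm =
  fixes N :: "'a::{metric_space, topological_ab_group_add} \<Rightarrow> real"
  assumes triangle: "N (x + y) \<le> N x + N y"
    and minus [simp]: "N (- x) = N x"
    and small_nhds: "open U \<Longrightarrow> 0 \<in> U \<Longrightarrow> \<exists>e>0. \<forall>x. N x < e \<longrightarrow> x \<in> U"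
    and tendsto_0: "(N \<longlongrightarrow> 0) (nhds 0)"
    and compact_ball: "\<exists>r>0. \<exists>K. compact K \<and> {x. N x \<le> r} \<subseteq> K"
begin

lemma zero [simp]: "N 0 = 0"
proof -
  have "N 0 < e" if "e > 0" for e
    using order_tendstoD(2)[OF tendsto_0 that] by (rule eventually_nhds_x_imp_x)
  moreover have "N 0 \<ge> 0"
    using triangle[of 0 0] by simp
  ultimately show ?thesis
    by (metis less_irrefl order_le_less)
qed

lemma nonneg: "N x \<ge> 0"
  using triangle[of x "- x"] by simp

lemma minus_commute: "N (x - y) = N (y - x)"
  by (metis minus minus_diff_eq)

lemma diff_triangle: "N (x - z) \<le> N (x - y) + N (y - z)"
  using triangle[of "x - y" "y - z"] by simp

lemma diff_le: "N (x - y) \<le> N x + N y"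
  using triangle[of x "- y"] by simp

lemma tendsto_iff_N: "(f \<longlongrightarrow> l) F \<longleftrightarrow> ((\<lambda>x. N (f x - l)) \<longlongrightarrow> 0) F"
proof
  assume "(f \<longlongrightarrow> l) F"
  then have "((\<lambda>x. f x - l) \<longlongrightarrow> 0) F"
    using tendsto_diff[of f l F "\<lambda>_. l" l] by simp
  then show "((\<lambda>x. N (f x - l)) \<longlongrightarrow> 0) F"
    using filterlim_compose[OF tendsto_0] by blast
next
  assume *: "((\<lambda>x. N (f x - l)) \<longlongrightarrow> 0) F"
  have "((\<lambda>x. f x - l) \<longlongrightarrow> 0) F"
  proof (rule topological_tendstoI)
    fix S :: "'a set" assume "open S" "0 \<in> S"
    then obtain e where e: "e > 0" "\<forall>x. N x < e \<longrightarrow> x \<in> S"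
      using small_nhds by blast
    show "\<forall>\<^sub>F x in F. f x - l \<in> S"
      using order_tendstoD(2)[OF * e(1)] by eventually_elim (use e in blast)
  qed
  then show "(f \<longlongrightarrow> l) F"
    using tendsto_add[of "\<lambda>x. f x - l" 0 F "\<lambda>_. l" l] by simp
qed

lemma LIMSEQ_iff_N: "f \<longlonglongrightarrow> l \<longleftrightarrow> (\<forall>e>0. \<exists>M. \<forall>n\<ge>M. N (f n - l) < e)"
  by (subst tendsto_iff_N) (simp add: LIMSEQ_def nonneg)

lemma continuous_on_N: "continuous_on A N"
proof (rule continuous_on_subset[OF _ subset_UNIV])
  have "(N \<longlongrightarrow> N l) (at l)" for l
  proof -
    have "((\<lambda>x. N (x - l)) \<longlongrightarrow> 0) (at l)"
      using tendsto_iff_N[of "\<lambda>x. x" l "at l"] by (simp add: tendsto_ident_at)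
    moreover have "\<bar>N x - N l\<bar> \<le> N (x - l)" for x
      using diff_triangle[of x 0 l] diff_triangle[of l 0 x] minus_commute[of x l] by simp
    ultimately have "((\<lambda>x. N x - N l) \<longlongrightarrow> 0) (at l)"
      by (metis (mono_tags, lifting) always_eventually real_norm_def Lim_null_comparison)
    then show ?thesis
      using LIM_zero_cancel by blast
  qed
  then show "continuous_on UNIV N"
    by (simp add: continuous_on_def)
qed

lemma open_N_ball: "open {x. N (x - a) < e}"
proof -
  have "continuous_on UNIV (\<lambda>x. N (x - a))"
    by (rule continuous_on_compose2[OF continuous_on_N[of UNIV]]) (auto intro!: continuous_intros)
  then show ?thesis
    by (intro open_Collect_less) (auto intro: continuous_intros)
qed

text \<open>Translation by \<open>f M\<close> moves the tail into the compact ball, where a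
  subsequence converges; the Cauchy condition carries this limit over to the whole sequence.\<close>

lemma N_Cauchy_convergent:
  assumes "\<And>e. e > 0 \<Longrightarrow> \<exists>M. \<forall>p\<ge>M. \<forall>q\<ge>M. N (f p - f q) \<le> e"
  shows "convergent f"
proof -
  obtain r K where r: "r > 0" "compact K" and rK: "{x. N x \<le> r} \<subseteq> K"
    using compact_ball by blast
  obtain M where M: "\<And>p q. p \<ge> M \<Longrightarrow> q \<ge> M \<Longrightarrow> N (f p - f q) \<le> r"
    using assms[OF r(1)] by blast
  have "\<forall>n. f (n + M) - f M \<in> K"
    using M rK by auto
  then obtain l s where s: "strict_mono s" "((\<lambda>n. f (n + M) - f M) \<circ> s) \<longlonglongrightarrow> l"
    using compact_imp_seq_compact[OF r(2)] by (elim seq_compactE) auto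
  have lim: "(\<lambda>n. f (s n + M)) \<longlonglongrightarrow> l + f M"
    using tendsto_add[OF s(2) tendsto_const[of "f M"]] by (simp add: o_def)
  have "f \<longlonglongrightarrow> l + f M"
    unfolding LIMSEQ_iff_N
  proof (intro allI impI)
    fix e :: real assume e: "e > 0"
    obtain P where P: "\<And>p q. p \<ge> P \<Longrightarrow> q \<ge> P \<Longrightarrow> N (f p - f q) \<le> e / 2"
      using assms[of "e / 2"] e by auto
    obtain K where K: "\<And>n. n \<ge> K \<Longrightarrow> N (f (s n + M) - (l + f M)) < e / 2"
      using lim e unfolding LIMSEQ_iff_N by (meson half_gt_zero)
    show "\<exists>M'. \<forall>n\<ge>M'. N (f n - (l + f M)) < e"
    proof (intro exI[of _ P] allI impI)
      fix n assume "n \<ge> P"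
      have "s (max K P) + M \<ge> P"
        using seq_suble[OF s(1), of "max K P"] by linarith
      then show "N (f n - (l + f M)) < e"
        using P[OF \<open>n \<ge> P\<close>, of "s (max K P) + M"] K[of "max K P"]
          diff_triangle[of "f n" "l + f M" "f (s (max K P) + M)"] by simp
    qed
  qed
  then show ?thesis
    by (auto simp: convergent_def)
qed

lemma convergent_imp_N_Cauchy:
  assumes "convergent f" "e > 0"
  obtains M where "\<And>p q. p \<ge> M \<Longrightarrow> q \<ge> M \<Longrightarrow> N (f p - f q) \<le> e"
proof -
  obtain l where "f \<longlonglongrightarrow> l"
    using assms by (auto simp: convergent_def)
  then obtain M where M: "\<And>n. n \<ge> M \<Longrightarrow> N (f n - l) < e / 2"
    using assms(2) unfolding LIMSEQ_iff_N by (meson half_gt_zero)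
  show ?thesis
  proof (rule that)
    fix p q assume "p \<ge> M" "q \<ge> M"
    then show "N (f p - f q) \<le> e"
      using M[of p] M[of q] diff_triangle[of "f p" "f q" l] minus_commute[of l "f q"] by simp
  qed
qed

lemma N_sum_le: "N (\<Sum>i\<in>A. f i) \<le> (\<Sum>i\<in>A. N (f i))"
  by (induction A rule: infinite_finite_induct) (auto intro: order_trans[OF triangle])

lemma summable_comparison_N:
  assumes "summable g" "\<And>k. N (f k) \<le> g k"
  shows "summable f"
proof -
  have "convergent (\<lambda>n. \<Sum>i<n. f i)"
  proof (rule N_Cauchy_convergent)
    fix e :: real assume "e > 0"
    then obtain M where M: "\<And>m n. m \<ge> M \<Longrightarrow> norm (\<Sum>i\<in>{m..<n}. g i) < e"
      using assms(1) unfolding summable_Cauchy by blast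
    have *: "N ((\<Sum>i<p. f i) - (\<Sum>i<q. f i)) \<le> e" if "q \<ge> M" "q \<le> p" for p q
    proof -
      have "(\<Sum>i<p. f i) - (\<Sum>i<q. f i) = (\<Sum>i\<in>{q..<p}. f i)"
        using that(2) by (metis sum_diff_nat_ivl atLeast0LessThan zero_le)
      also have "N \<dots> \<le> (\<Sum>i\<in>{q..<p}. g i)"
        by (rule order_trans[OF N_sum_le sum_mono]) (rule assms)
      finally show ?thesis
        using M[OF that(1), of p] by simp
    qed
    show "\<exists>M. \<forall>p\<ge>M. \<forall>q\<ge>M. N ((\<Sum>i<p. f i) - (\<Sum>i<q. f i)) \<le> e"
      using * minus_commute by (metis linear)
  qed
  then show ?thesis
    by (simp add: summable_iff_convergent)
qed

end

text \<open>\<open>N x\<close> is the sup distance between a bump function at 0 and its translate by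
  \<open>x\<close>. The sup norm is translation invariant, whence subadditivity and symmetry;
  comparing values at 0 shows that a small \<open>N x\<close> keeps \<open>x\<close> near 0.\<close>

lemma locally_compact_group_norm:
  assumes "locally_compact_space (euclidean :: 'a::{metric_space, topological_ab_group_add} topology)"
  obtains N :: "'a::{metric_space, topological_ab_group_add} \<Rightarrow> real" where "group_norm N"
proof -
  obtain U K :: "'a set" where UK: "open U" "compact K" "0 \<in> U" "U \<subseteq> K"
    using assms unfolding locally_compact_space_def by simp blast
  then obtain r where r: "r > 0" "cball 0 r \<subseteq> U"
    using open_contains_cball[of U] by auto
  then have K: "compact (cball (0::'a) r)"
    using UK by (metis closed_cball compact_Int_closed inf.absorb_iff2 subset_trans)
  \<comment> \<open>a compactly supported bump function, hence uniformly continuous for the group uniformity\<close>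
  define f where "f y = max 0 (r - dist 0 y)" for y :: 'a
  have f_bounds: "0 \<le> f y" "f y \<le> r" for y
    using r by (auto simp: f_def)
  have f_cont: "continuous_on UNIV f"
    unfolding f_def by (intro continuous_intros)
  define N where "N x = (SUP y. \<bar>f (x + y) - f y\<bar>)" for x
  have osc: "\<bar>f u - f v\<bar> \<le> r" for u v
    using f_bounds[of u] f_bounds[of v] by linarith
  have bdd: "bdd_above (range (\<lambda>y. \<bar>f (x + y) - f y\<bar>))" for x
    using osc by (intro bdd_aboveI2[of _ _ r])
  have N_ge: "\<bar>f (x + y) - f y\<bar> \<le> N x" for x y
    unfolding N_def by (rule cSUP_upper[OF _ bdd]) simp
  have N_le: "N x \<le> c" if "\<And>y. \<bar>f (x + y) - f y\<bar> \<le> c" for x c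
    unfolding N_def using that by (intro cSUP_least) auto
  have tri: "N (x + y) \<le> N x + N y" for x y
  proof (rule N_le)
    fix u
    show "\<bar>f (x + y + u) - f u\<bar> \<le> N x + N y"
      using N_ge[of x "y + u"] N_ge[of y u] by (simp add: add.assoc)
  qed
  have neg_le: "N (- x) \<le> N x" for x
  proof (rule N_le)
    fix u
    show "\<bar>f (- x + u) - f u\<bar> \<le> N x"
      using N_ge[of x "- x + u"] by (simp add: abs_minus_commute)
  qed
  then have neg: "N (- x) = N x" for x
    by (metis antisym minus_minus)
  have dist_le: "min r (dist 0 x) \<le> N x" for x
    using N_ge[of x 0] r by (auto simp: f_def)
  have small: "\<exists>e>0. \<forall>x. N x < e \<longrightarrow> x \<in> U" if U: "open U" "0 \<in> U" for U
  proof -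
    obtain e where e: "e > 0" "ball 0 e \<subseteq> U"
      using openE[OF U] by blast
    show ?thesis
    proof (intro exI[of _ "min e r"] conjI allI impI)
      fix x assume "N x < min e r"
      then have "dist 0 x < e"
        using dist_le[of x] by auto
      then show "x \<in> U"
        using e by auto
    qed (use e r in auto)
  qed
  have seq: "(\<lambda>n. N (x n)) \<longlonglongrightarrow> 0" if x: "x \<longlonglongrightarrow> 0" for x
  proof (rule ccontr)
    assume "\<not> (\<lambda>n. N (x n)) \<longlonglongrightarrow> 0"
    then obtain e where e: "e > 0" "\<forall>M. \<exists>n\<ge>M. \<not> \<bar>N (x n)\<bar> < e"
      unfolding LIMSEQ_def by auto
    have "N x \<ge> 0" for x
      using N_ge[of x 0] by linarith
    have "\<exists>n\<ge>M. \<exists>y. \<bar>f (x n + y) - f y\<bar> > e / 2" for M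
    proof -
      obtain n where n: "n \<ge> M" "N (x n) \<ge> e"
        using e(2) \<open>\<And>x. N x \<ge> 0\<close> by (metis abs_of_nonneg not_less)
      then have "\<not> N (x n) \<le> e / 2"
        using e(1) by simp
      then show ?thesis
        using N_le n(1) by (meson not_le)
    qed
    then obtain n y where n: "\<And>M. n M \<ge> M" "\<And>M. \<bar>f (x (n M) + y M) - f (y M)\<bar> > e / 2"
      by metis
    define x' where "x' M = x (n M)" for M
    have x': "x' \<longlonglongrightarrow> 0"
      unfolding x'_def by (rule filterlim_compose[OF x])
        (rule filterlim_at_top_mono[OF filterlim_ident], use n in auto)
    have f_out: "f v = 0" if "v \<notin> cball 0 r" for v
      using that by (auto simp: f_def)
    \<comment> \<open>At least one of \<open>y M\<close> and \<open>x' M + y M\<close> lies in the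
      compact ball, since otherwise \<open>f\<close> vanishes at both. \<open>b\<close> selects such
      a point and \<open>c\<close> below the other one; both have the same limit along a subsequence
      because \<open>x'\<close> tends to 0.\<close>
    define b where "b M = (if y M \<in> cball 0 r then y M else x' M + y M)" for M
    have "b M \<in> cball 0 r" for M
      using n(2)[of M] f_out[of "y M"] f_out[of "x' M + y M"] e(1)
      by (cases "x' M + y M \<in> cball 0 r"; cases "y M \<in> cball 0 r") (simp_all add: b_def x'_def)
    with K obtain l s where s: "strict_mono s" "(b \<circ> s) \<longlonglongrightarrow> l"
      unfolding compact_eq_seq_compact_metric seq_compact_def by blast
    have xs: "(\<lambda>k. x' (s k)) \<longlonglongrightarrow> 0"
      using LIMSEQ_subseq_LIMSEQ[OF x' s(1)] by (simp add: o_def)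
    define c where "c k = (if y (s k) \<in> cball 0 r then x' (s k) + b (s k) else b (s k) - x' (s k))" for k
    have "c \<longlonglongrightarrow> l"
    proof (rule topological_tendstoI)
      fix S assume S: "open S" "l \<in> S"
      have "(\<lambda>k. x' (s k) + b (s k)) \<longlonglongrightarrow> l" "(\<lambda>k. b (s k) - x' (s k)) \<longlonglongrightarrow> l"
        using tendsto_add[OF xs s(2)] tendsto_diff[OF s(2) xs] by (simp_all add: o_def)
      from topological_tendstoD[OF this(1) S] topological_tendstoD[OF this(2) S]
      show "\<forall>\<^sub>F k in sequentially. c k \<in> S"
        by eventually_elim (auto simp: c_def)
    qed
    then have "(\<lambda>k. \<bar>f (c k) - f (b (s k))\<bar>) \<longlonglongrightarrow> \<bar>f l - f l\<bar>"
      using s(2) f_cont by (intro tendsto_intros continuous_on_tendsto_compose[OF f_cont]) (auto simp: o_def)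
    moreover have "\<bar>f (c k) - f (b (s k))\<bar> \<ge> e / 2" for k
      using n(2)[of "s k"] by (auto simp: c_def b_def x'_def abs_minus_commute)
    ultimately show False
      using e(1) LIMSEQ_le_const by fastforce
  qed
  have lim: "(N \<longlongrightarrow> 0) (nhds 0)"
  proof -
    have "N 0 = 0"
      by (simp add: N_def)
    moreover have "(N \<longlongrightarrow> 0) (at 0)"
      unfolding tendsto_at_iff_sequentially using seq by (auto simp: o_def)
    ultimately show ?thesis
      by (metis tendsto_at_iff_tendsto_nhds)
  qed
  \<comment> \<open>Half of \<open>r\<close>, because \<open>dist_le\<close> bounds the distance
    only where \<open>N x\<close> is below \<open>r\<close>.\<close>
  have "{x. N x \<le> r / 2} \<subseteq> cball 0 r"
  proof
    fix x assume "x \<in> {x. N x \<le> r / 2}"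
    then show "x \<in> cball 0 r"
      using dist_le[of x] r by (auto simp: min_def split: if_splits)
  qed
  then have "\<exists>r>0. \<exists>K. compact K \<and> {x. N x \<le> r} \<subseteq> K"
    using K r by (intro exI[of _ "r / 2"]) auto
  with tri neg small lim have "group_norm N"
    unfolding group_norm_def by blast
  then show ?thesis
    by (rule that)
qed

section \<open>Baire category\<close>

text \<open>The Baire property of Borel sets. The comeager set is kept as a countable family of
  dense open sets, so that a countable union merely merges families.\<close>

lemma borel_Baire_property:
  fixes B :: "'x::topological_space set"
  assumes "B \<in> sets borel"
  shows "\<exists>U \<G>. open U \<and> countable \<G> \<and> (\<forall>T\<in>\<G>. open T \<and> closure T = UNIV) \<and> (\<forall>x\<in>\<Inter>\<G>. x \<in> B \<longleftrightarrow> x \<in> U)"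
proof -
  have "B \<in> sigma_sets UNIV {S. open S}"
    using assms by (simp add: borel_def)
  then show ?thesis
  proof (induction rule: sigma_sets.induct)
    case (Basic B)
    then show ?case
      by (intro exI[of _ B] exI[of _ "{}"]) auto
  next
    case Empty
    then show ?case
      by (intro exI[of _ "{}"]) auto
  next
    case (Compl B)
    then obtain U \<G> where U: "open U" "countable \<G>" "\<forall>T\<in>\<G>. open T \<and> closure T = UNIV"
      "\<forall>x\<in>\<Inter>\<G>. x \<in> B \<longleftrightarrow> x \<in> U"
      by blast
    \<comment> \<open>The boundary of \<open>U\<close> belongs neither to \<open>U\<close> nor to
      \<open>- closure U\<close>; one further dense open set removes it.\<close>
    have "closure U \<union> closure (- closure U) = UNIV"
      using closure_subset[of "- closure U"] by auto
    then show ?case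
      using U by (intro exI[of _ "- closure U"] exI[of _ "insert (U \<union> - closure U) \<G>"])
        (auto simp: closure_subset[THEN subsetD])
  next
    case (Union B)
    then obtain U \<G> where U: "\<And>i. open (U i)" "\<And>i::nat. countable (\<G> i)"
      "\<And>i. \<forall>T\<in>\<G> i. open T \<and> closure T = UNIV" "\<And>i. \<forall>x\<in>\<Inter>(\<G> i). x \<in> B i \<longleftrightarrow> x \<in> U i"
      by metis
    show ?case
      using U by (intro exI[of _ "\<Union>i. U i"] exI[of _ "\<Union>i. \<G> i"]) auto
  qed
qed

text \<open>Merging the families of all members of \<open>\<B>\<close> leaves one comeager set on
  which each member is relatively open. In this way a Borel map becomes continuous off a meager
  set.\<close>

lemma countable_borel_relatively_open:
  fixes \<B> :: "'x::topological_space set set"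
  assumes "countable \<B>" "\<B> \<subseteq> sets borel"
  obtains \<G> where "countable \<G>" "\<And>T. T \<in> \<G> \<Longrightarrow> open T \<and> closure T = UNIV"
    "\<And>B x. B \<in> \<B> \<Longrightarrow> x \<in> B \<Longrightarrow> x \<in> \<Inter>\<G> \<Longrightarrow> \<exists>U. open U \<and> x \<in> U \<and> U \<inter> \<Inter>\<G> \<subseteq> B"
proof -
  define P where "P B U \<G> \<longleftrightarrow> open U \<and> countable \<G> \<and> (\<forall>T\<in>\<G>. open T \<and> closure T = UNIV) \<and>
    (\<forall>x\<in>\<Inter>\<G>. x \<in> B \<longleftrightarrow> x \<in> U)" for B U :: "'x set" and \<G>
  have "\<forall>B\<in>\<B>. \<exists>U \<G>. P B U \<G>"
    using borel_Baire_property assms(2) unfolding P_def by blast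
  then obtain U \<G> where P: "\<And>B. B \<in> \<B> \<Longrightarrow> P B (U B) (\<G> B)"
    by metis
  then have U: "\<And>B. B \<in> \<B> \<Longrightarrow> open (U B)" "\<And>B. B \<in> \<B> \<Longrightarrow> countable (\<G> B)"
      "\<And>B. B \<in> \<B> \<Longrightarrow> \<forall>T\<in>\<G> B. open T \<and> closure T = UNIV"
      "\<And>B. B \<in> \<B> \<Longrightarrow> \<forall>x\<in>\<Inter>(\<G> B). x \<in> B \<longleftrightarrow> x \<in> U B"
    unfolding P_def by blast+
  show ?thesis
  proof (rule that[of "\<Union>B\<in>\<B>. \<G> B"])
    fix B x assume B: "B \<in> \<B>" "x \<in> B" "x \<in> \<Inter>(\<Union>B\<in>\<B>. \<G> B)"
    then have "y \<in> B \<longleftrightarrow> y \<in> U B" if "y \<in> \<Inter>(\<Union>B\<in>\<B>. \<G> B)" for y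
      using U(4)[OF B(1)] that by blast
    then show "\<exists>V. open V \<and> x \<in> V \<and> V \<inter> \<Inter>(\<Union>B\<in>\<B>. \<G> B) \<subseteq> B"
      using U(1) B by blast
  qed (use U assms in auto)
qed

lemma polish_Baire_category:
  fixes \<G> :: "'x::polish_space set set"
  assumes "countable \<G>" "\<And>T. T \<in> \<G> \<Longrightarrow> open T \<and> closure T = UNIV"
  shows "\<Inter>\<G> \<noteq> {}"
proof -
  have "euclidean closure_of \<Inter>\<G> = topspace (euclidean :: 'x topology)"
    using assms by (intro Baire_category) (auto simp: completely_metrizable_space_euclidean)
  then show ?thesis
    by (metis closure_of_empty empty_not_UNIV topspace_euclidean)
qed

text \<open>A basic open set constrains finitely many coordinates. Exact agreement is a convenient
  form of nearness here, since a late jump leaves all earlier coordinates untouched.\<close>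

lemma open_fun_agree:
  fixes U :: "(nat \<Rightarrow> 'a::topological_space) set"
  assumes "open U" "x \<in> U"
  shows "\<exists>n. \<forall>y. (\<forall>i<n. y i = x i) \<longrightarrow> y \<in> U"
proof -
  obtain X where X: "x \<in> Pi\<^sub>E UNIV X" "finite {i. X i \<noteq> UNIV}" "Pi\<^sub>E UNIV X \<subseteq> U"
    using product_topology_open_contains_basis[of "\<lambda>_. euclidean" UNIV U x] assms
    unfolding open_fun_def by auto
  obtain n where n: "\<forall>i\<in>{i. X i \<noteq> UNIV}. i < n"
    using X(2) finite_nat_set_iff_bounded by blast
  have "y \<in> U" if "\<forall>i<n. y i = x i" for y
    using X n that by (intro subsetD[OF X(3)] PiE_I) (auto simp: PiE_iff, metis UNIV_I)
  then show ?thesis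
    by blast
qed

section \<open>Generic points of a reduction\<close>

text \<open>A pair (n, g) stands for the sequence that jumps from 0 to g at time n.\<close>

definition walk :: "(nat \<times> 'a::ab_group_add) list \<Rightarrow> nat \<Rightarrow> 'a" where
  "walk l i = (\<Sum>(n, g)\<leftarrow>l. if n \<le> i then g else 0)"

definition shift :: "(nat \<Rightarrow> 'a::ab_group_add) \<Rightarrow> (nat \<times> 'a) list \<Rightarrow> nat \<Rightarrow> 'a" where
  "shift x l i = x i + walk l i"

lemma walk_simps [simp]:
  "walk [] i = 0" "walk ((n, g) # l) i = (if n \<le> i then g else 0) + walk l i"
  by (simp_all add: walk_def)

lemma shift_Nil [simp]: "shift x [] = x"
  by (simp add: shift_def fun_eq_iff)

lemma shift_shift_Cons: "shift (shift x [a]) l = shift x (a # l)"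
  by (cases a) (simp add: shift_def fun_eq_iff add.assoc)

lemma convergent_walk: "convergent (walk l :: nat \<Rightarrow> 'a::topological_ab_group_add)"
proof (induction l)
  case Nil
  have "walk [] = (\<lambda>_. 0 :: 'a)"
    by (simp add: fun_eq_iff)
  then show ?case
    by (simp add: convergent_const)
next
  case (Cons a l)
  obtain n g where a: "a = (n, g)"
    by (cases a)
  have "\<forall>\<^sub>F i in sequentially. (if n \<le> i then g else 0) = g"
    using eventually_ge_at_top[of n] by eventually_elim simp
  then have "(\<lambda>i. if n \<le> i then g else 0) \<longlonglongrightarrow> g"
    by (rule tendsto_eventually)
  then have "convergent (\<lambda>i. (if n \<le> i then g else 0) + walk l i)"
    using Cons tendsto_add unfolding convergent_def by blast
  moreover have "walk (a # l) = (\<lambda>i. (if n \<le> i then g else 0) + walk l i)"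
    by (simp add: a fun_eq_iff)
  ultimately show ?case
    by simp
qed

lemma continuous_on_shift:
  "continuous_on UNIV (\<lambda>x. shift x l :: nat \<Rightarrow> 'a::topological_ab_group_add)"
  unfolding shift_def
  by (intro continuous_on_coordinatewise_then_product continuous_intros)
     (auto intro: continuous_on_product_then_coordinatewise)

text \<open>Shifting is a homeomorphism with inverse \<open>?h\<close>. This allows a point to be
  chosen all of whose shifts are generic.\<close>

lemma dense_shift_vimage:
  fixes G :: "(nat \<Rightarrow> 'a::topological_ab_group_add) set"
  assumes "closure G = UNIV"
  shows "closure ((\<lambda>x. shift x l) -` G) = UNIV"
proof -
  have "W \<inter> (\<lambda>x. shift x l) -` G \<noteq> {}" if W: "open W" "W \<noteq> {}" for W
  proof -
    let ?h = "\<lambda>y i. y i - walk l i"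
    have "continuous_on UNIV ?h"
      by (intro continuous_on_coordinatewise_then_product continuous_intros)
         (auto intro: continuous_on_product_then_coordinatewise)
    then have opn: "open (?h -` W)"
      using W by (intro open_vimage)
    obtain w where w: "w \<in> W"
      using W by blast
    have "?h (shift w l) = w"
      by (simp add: shift_def fun_eq_iff)
    then have "shift w l \<in> ?h -` W"
      using w by simp
    then have "?h -` W \<inter> G \<noteq> {}"
      using open_Int_closure_eq_empty[OF opn, of G] assms by auto
    then obtain y where "y \<in> G" "?h y \<in> W"
      by blast
    moreover have "shift (?h y) l = y"
      by (simp add: shift_def fun_eq_iff)
    ultimately show ?thesis
      by (metis IntI empty_iff vimageI)
  qed
  from this[of "- closure ((\<lambda>x. shift x l) -` G)"]
  have "- closure ((\<lambda>x. shift x l) -` G) = {}"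
    using closure_subset[of "(\<lambda>x. shift x l) -` G"] by auto
  then show ?thesis
    by auto
qed

text \<open>An interface that hides measurability and category. In the intended instance
  \<open>T\<close> enumerates dense open sets, kept separate so that a point built in stages can be
  put into \<open>T k\<close> at stage \<open>k\<close>. \<open>\<theta>_agree\<close> is continuity
  of the coordinates of \<open>\<theta>\<close> on their intersection; \<open>tail_agree\<close>
  says that the effect of a shift settles at a common time for all generic points near
  \<open>z\<close>.\<close>

locale generic_reduction = G: group_norm NG + H: group_norm NH
  for NG :: "'a::{polish_space, topological_ab_group_add} \<Rightarrow> real"
    and NH :: "'b::{polish_space, topological_ab_group_add} \<Rightarrow> real" +
  fixes D :: "'a set" and \<theta> :: "(nat \<Rightarrow> 'a) \<Rightarrow> nat \<Rightarrow> 'b"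
    and T :: "nat \<Rightarrow> (nat \<Rightarrow> 'a) set" and z :: "nat \<Rightarrow> 'a"
  assumes subgroup_D: "is_subgroup D"
    and reduction: "convergent (\<lambda>i. x i - y i) \<longleftrightarrow> convergent (\<lambda>p. \<theta> x p - \<theta> y p)"
    and T_agree: "x \<in> T k \<Longrightarrow> \<exists>n. \<forall>y. (\<forall>i<n. y i = x i) \<longrightarrow> y \<in> T k"
    and shift_generic: "l \<in> lists (UNIV \<times> D) \<Longrightarrow> shift z l \<in> (\<Inter>k. T k)"
    and \<theta>_agree: "x \<in> (\<Inter>k. T k) \<Longrightarrow> e > 0 \<Longrightarrow>
      \<exists>n. \<forall>y\<in>\<Inter>k. T k. (\<forall>i<n. y i = x i) \<longrightarrow> NH (\<theta> y p - \<theta> x p) < e"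
    and tail_agree: "l \<in> lists (UNIV \<times> D) \<Longrightarrow> e > 0 \<Longrightarrow>
      \<exists>m n. \<forall>y\<in>\<Inter>k. T k. (\<forall>i<n. y i = z i) \<longrightarrow> (\<forall>p\<ge>m. \<forall>q\<ge>m.
        NH ((\<theta> (shift y l) p - \<theta> y p) - (\<theta> (shift y l) q - \<theta> y q)) \<le> e)"

text \<open>Two countable families of Borel sets are made relatively open: \<open>B p b\<close>, for
  continuity of the coordinates of \<open>\<theta>\<close>, and \<open>A l m k\<close>, for the time
  at which the effect of \<open>l\<close> settles. Since \<open>D\<close> is countable, so are the
  lists, and Baire category gives a \<open>z\<close> whose shifts are all generic.\<close>

lemma generic_reduction_exists:
  fixes \<theta> :: "(nat \<Rightarrow> 'a::{polish_space, topological_ab_group_add}) \<Rightarrow> nat \<Rightarrow> 'b::{polish_space, topological_ab_group_add}"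
  assumes NG: "group_norm NG" and NH: "group_norm NH"
    and D: "is_subgroup D" "countable D"
    and \<theta>: "\<theta> \<in> borel_measurable borel"
    and red: "\<And>x y. convergent (\<lambda>i. x i - y i) \<longleftrightarrow> convergent (\<lambda>p. \<theta> x p - \<theta> y p)"
  obtains T z where "generic_reduction NG NH D \<theta> T z"
proof -
  interpret G: group_norm NG by (rule NG)
  interpret H: group_norm NH by (rule NH)
  obtain Bs :: "'b set set" where Bs: "countable Bs" "topological_basis Bs"
    using ex_countable_basis by blast
  define \<Gamma> where "\<Gamma> = lists ((UNIV :: nat set) \<times> D)"
  have \<Gamma>: "countable \<Gamma>"
    unfolding \<Gamma>_def using D by (intro countable_lists countable_SIGMA) auto
  define \<Delta> where "\<Delta> l x p = \<theta> (shift x l) p - \<theta> x p" for l x p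
  define A where "A l m k = {x. \<forall>p\<ge>m. \<forall>q\<ge>m. NH (\<Delta> l x p - \<Delta> l x q) \<le> inverse (real (Suc k))}" for l m k
  define B where "B p b = {x. \<theta> x p \<in> b}" for p b
  have \<theta>p [measurable]: "(\<lambda>x. \<theta> x p) \<in> borel_measurable borel" for p
    using \<theta> by (rule measurable_compose) (auto intro!: borel_measurable_continuous_onI continuous_on_product_then_coordinatewise)
  have \<theta>s [measurable]: "(\<lambda>x. \<theta> (shift x l) p) \<in> borel_measurable borel" for l p
    using borel_measurable_continuous_onI[OF continuous_on_shift] \<theta>p by (rule measurable_compose)
  have diff: "(\<lambda>x. u x - v x) \<in> borel_measurable borel"
    if "u \<in> borel_measurable borel" "v \<in> borel_measurable borel" for u v :: "(nat \<Rightarrow> 'a) \<Rightarrow> 'b"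
    using that by (rule borel_measurable_continuous_Pair) (auto intro!: continuous_intros)
  have NHm: "NH \<in> borel_measurable borel"
    by (intro borel_measurable_continuous_onI H.continuous_on_N)
  have [measurable]: "(\<lambda>x. NH (\<Delta> l x p - \<Delta> l x q)) \<in> borel_measurable borel" for l p q
    unfolding \<Delta>_def by (rule measurable_compose[OF _ NHm]) (intro diff \<theta>p \<theta>s)
  have A: "A l m k \<in> sets borel" for l m k
  proof -
    have "{x \<in> space borel. \<forall>p\<ge>m. \<forall>q\<ge>m. NH (\<Delta> l x p - \<Delta> l x q) \<le> inverse (real (Suc k))} \<in> sets borel"
      by measurable
    then show ?thesis
      by (simp add: A_def)
  qed
  have B: "B p b \<in> sets borel" if "b \<in> Bs" for p b
    using measurable_sets[OF \<theta>p, of b p] topological_basis_open[OF Bs(2) that]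
    by (simp add: B_def vimage_def)
  define \<B> where "\<B> = (\<Union>p. B p ` Bs) \<union> (\<Union>l\<in>\<Gamma>. \<Union>m. range (A l m))"
  have "countable \<B>" "\<B> \<subseteq> sets borel"
    unfolding \<B>_def using Bs \<Gamma> A B by auto
  then obtain \<G> where \<G>: "countable \<G>" "\<And>T. T \<in> \<G> \<Longrightarrow> open T \<and> closure T = UNIV"
    "\<And>B x. B \<in> \<B> \<Longrightarrow> x \<in> B \<Longrightarrow> x \<in> \<Inter>\<G> \<Longrightarrow> \<exists>U. open U \<and> x \<in> U \<and> U \<inter> \<Inter>\<G> \<subseteq> B"
    using countable_borel_relatively_open by metis
  \<comment> \<open>\<open>UNIV\<close> makes the family nonempty, so that it can be
    enumerated.\<close>
  define T where "T = from_nat_into (insert UNIV \<G>)"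
  have rT: "range T = insert UNIV \<G>"
    unfolding T_def using \<G>(1) by (intro range_from_nat_into) auto
  then have C: "(\<Inter>k. T k) = \<Inter>\<G>"
    by auto
  have Topen: "open (T k)" for k
    using rT \<G>(2) by (metis insertE open_UNIV rangeI)
  define \<G>' where "\<G>' = (\<Union>l\<in>\<Gamma>. (\<lambda>S. (\<lambda>x. shift x l) -` S) ` \<G>)"
  have "countable \<G>'"
    unfolding \<G>'_def using \<Gamma> \<G>(1) by auto
  moreover have "open S \<and> closure S = UNIV" if "S \<in> \<G>'" for S
    using that \<G>(2) unfolding \<G>'_def by (auto intro!: open_vimage continuous_on_shift simp: dense_shift_vimage)
  ultimately have "\<Inter>\<G>' \<noteq> {}"
    by (rule polish_Baire_category)
  then obtain z where z: "z \<in> \<Inter>\<G>'"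
    by blast
  have sz: "shift z l \<in> \<Inter>\<G>" if "l \<in> \<Gamma>" for l
    using z that unfolding \<G>'_def by blast
  have "[] \<in> \<Gamma>"
    by (simp add: \<Gamma>_def)
  with sz[of "[]"] have zC: "z \<in> \<Inter>\<G>"
    by simp
  have "generic_reduction NG NH D \<theta> T z"
  proof (intro generic_reduction.intro generic_reduction_axioms.intro NG NH D red, unfold C \<Gamma>_def[symmetric] \<Delta>_def[symmetric])
    fix x k assume "x \<in> T k"
    then show "\<exists>n. \<forall>y. (\<forall>i<n. y i = x i) \<longrightarrow> y \<in> T k"
      by (intro open_fun_agree Topen)
  next
    fix x e p assume x: "x \<in> \<Inter>\<G>" and e: "(0::real) < e"
    have "\<theta> x p \<in> {v. NH (v - \<theta> x p) < e}"
      using e by simp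
    then obtain b where b: "b \<in> Bs" "\<theta> x p \<in> b" "b \<subseteq> {v. NH (v - \<theta> x p) < e}"
      by (rule topological_basisE[OF Bs(2) H.open_N_ball])
    obtain U where "open U" "x \<in> U" "U \<inter> \<Inter>\<G> \<subseteq> B p b"
      using \<G>(3)[of "B p b" x] b x by (auto simp: \<B>_def B_def)
    with open_fun_agree[of U x] b show "\<exists>n. \<forall>y\<in>\<Inter>\<G>. (\<forall>i<n. y i = x i) \<longrightarrow> NH (\<theta> y p - \<theta> x p) < e"
      unfolding B_def by blast
  next
    fix l e assume l: "l \<in> \<Gamma>" and e: "(0::real) < e"
    obtain k where k: "inverse (real (Suc k)) < e"
      using reals_Archimedean[OF e] by blast
    \<comment> \<open>Walks converge, so the reduction puts \<open>z\<close> itself into some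
      \<open>A l m k\<close>; relative openness extends this \<open>m\<close> to the generic points
      near \<open>z\<close>.\<close>
    have "convergent (\<lambda>i. shift z l i - z i)"
      using convergent_walk[of l] by (simp add: shift_def)
    then have "convergent (\<Delta> l z)"
      unfolding \<Delta>_def by (simp add: red)
    then obtain m where "\<And>p q. p \<ge> m \<Longrightarrow> q \<ge> m \<Longrightarrow> NH (\<Delta> l z p - \<Delta> l z q) \<le> inverse (real (Suc k))"
      by (rule H.convergent_imp_N_Cauchy[where e = "inverse (real (Suc k))"]) (simp, blast)
    then have "z \<in> A l m k"
      by (simp add: A_def)
    moreover have "A l m k \<in> \<B>"
      unfolding \<B>_def by (intro UnI2 UN_I[OF l] UN_I[of m, OF UNIV_I] rangeI)
    ultimately have "\<exists>U. open U \<and> z \<in> U \<and> U \<inter> \<Inter>\<G> \<subseteq> A l m k"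
      using zC by (intro \<G>(3))
    then obtain U where "open U" "z \<in> U" "U \<inter> \<Inter>\<G> \<subseteq> A l m k"
      by blast
    moreover obtain n where "\<forall>y. (\<forall>i<n. y i = z i) \<longrightarrow> y \<in> U"
      using open_fun_agree \<open>open U\<close> \<open>z \<in> U\<close> by blast
    ultimately have "\<forall>y\<in>\<Inter>\<G>. (\<forall>i<n. y i = z i) \<longrightarrow> (\<forall>p\<ge>m. \<forall>q\<ge>m. NH (\<Delta> l y p - \<Delta> l y q) \<le> inverse (real (Suc k)))"
      unfolding A_def by blast
    with k show "\<exists>m n. \<forall>y\<in>\<Inter>\<G>. (\<forall>i<n. y i = z i) \<longrightarrow> (\<forall>p\<ge>m. \<forall>q\<ge>m. NH (\<Delta> l y p - \<Delta> l y q) \<le> e)"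
      by (meson less_imp_le order_trans)
  qed (use sz in auto)
  then show ?thesis
    by (rule that)
qed

section \<open>Fusion\<close>

text \<open>An infinite walk. For strictly increasing \<open>n\<close> the bound
  \<open>Suc i\<close> loses nothing, since \<open>n k \<le> i\<close> forces
  \<open>k \<le> i\<close>.\<close>

definition stretch :: "(nat \<Rightarrow> nat) \<Rightarrow> (nat \<Rightarrow> 'a::ab_group_add) \<Rightarrow> nat \<Rightarrow> 'a" where
  "stretch n d i = (\<Sum>k<Suc i. if n k \<le> i then d k else 0)"

lemma stretch_eq:
  assumes "strict_mono n" "i < n k"
  shows "stretch n d i = (\<Sum>j<k. if n j \<le> i then d j else 0)"
proof -
  have "n j > i" if "j \<ge> k" for j
    using that assms by (metis strict_mono_less_eq less_le_trans)
  moreover have "n j > i" if "j \<ge> Suc i" for j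
    using that strict_mono_imp_increasing[OF assms(1), of j] by linarith
  ultimately have "(\<Sum>j<Suc i. if n j \<le> i then d j else 0) = (\<Sum>j<max k (Suc i). if n j \<le> i then d j else 0)"
    "(\<Sum>j<k. if n j \<le> i then d j else 0) = (\<Sum>j<max k (Suc i). if n j \<le> i then d j else 0)"
    by (intro sum.mono_neutral_left; force simp: not_le)+
  then show ?thesis
    by (simp add: stretch_def)
qed

lemma stretch_diff: "stretch n c i - stretch n d i = stretch n (\<lambda>k. c k - d k) i"
  unfolding stretch_def sum_subtractf[symmetric] by (intro sum.cong) auto

text \<open>The stretched sequence runs through the partial sums, holding each one until the next
  jump.\<close>

lemma convergent_stretch_iff:
  fixes d :: "nat \<Rightarrow> 'a::topological_ab_group_add"
  assumes n: "strict_mono n"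
  shows "convergent (stretch n d) \<longleftrightarrow> summable d"
proof
  assume "convergent (stretch n d)"
  then have "convergent (\<lambda>k. stretch n d (n k))"
    using convergent_subseq_convergent[OF _ n] by (simp add: o_def)
  moreover have "stretch n d (n k) = (\<Sum>j\<le>k. d j)" for k
  proof -
    have "stretch n d (n k) = (\<Sum>j<Suc k. if n j \<le> n k then d j else 0)"
      using n by (intro stretch_eq) (auto simp: strict_mono_less)
    also have "\<dots> = (\<Sum>j\<le>k. d j)"
      using n by (intro sum.cong) (auto simp: strict_mono_less_eq)
    finally show ?thesis .
  qed
  ultimately show "summable d"
    by (simp add: summable_iff_convergent')
next
  assume "summable d"
  then obtain l where l: "(\<lambda>k. \<Sum>j<k. d j) \<longlonglongrightarrow> l"
    unfolding summable_def sums_def by blast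
  have "stretch n d \<longlonglongrightarrow> l"
  proof (rule topological_tendstoI)
    fix U assume "open U" "l \<in> U"
    then obtain K where K: "\<And>k. k \<ge> K \<Longrightarrow> (\<Sum>j<k. d j) \<in> U"
      using topological_tendstoD[OF l] unfolding eventually_sequentially by blast
    have "stretch n d i \<in> U" if i: "i \<ge> n K" for i
    proof -
      define k where "k = (LEAST k. n k > i)"
      have "n (Suc i) > i"
        using strict_mono_imp_increasing[OF n, of "Suc i"] by simp
      then have k: "n k > i"
        unfolding k_def by (rule LeastI)
      have "n j \<le> i" if "j < k" for j
        using that not_less_Least[of j "\<lambda>k. n k > i"] unfolding k_def by simp
      then have "stretch n d i = (\<Sum>j<k. d j)"
        by (simp add: stretch_eq[OF n k])
      moreover have "K \<le> k"
        using k i n by (metis le_less_trans less_imp_le strict_mono_less)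
      ultimately show ?thesis
        using K by simp
    qed
    then show "\<forall>\<^sub>F i in sequentially. stretch n d i \<in> U"
      unfolding eventually_sequentially by blast
  qed
  then show "convergent (stretch n d)"
    by (auto simp: convergent_def)
qed

text \<open>Latest jump first: a further jump is then a \<open>Cons\<close>, the form in which
  additivity is available, and \<open>take 1\<close> yields the last jump alone.\<close>

definition steps :: "(nat \<Rightarrow> nat) \<Rightarrow> (nat \<Rightarrow> 'a) \<Rightarrow> nat \<Rightarrow> (nat \<times> 'a) list" where
  "steps n c k = rev (map (\<lambda>j. (n j, c j)) [0..<k])"

lemma steps_simps [simp]: "steps n c 0 = []" "steps n c (Suc k) = (n k, c k) # steps n c k"
  by (simp_all add: steps_def)

lemma walk_steps: "walk (steps n c k) i = (\<Sum>j<k. if n j \<le> i then c j else 0)"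
  by (induction k) (auto simp: add.commute)

section \<open>Additivity of late jumps and the fusion construction\<close>

context generic_reduction
begin

abbreviation "\<Gamma> \<equiv> lists (UNIV \<times> D)"

definition \<Delta> :: "(nat \<times> 'a) list \<Rightarrow> nat \<Rightarrow> 'b" where
  "\<Delta> l p = \<theta> (shift z l) p - \<theta> z p"

definition \<Lambda> :: "(nat \<times> 'a) list \<Rightarrow> 'b" where
  "\<Lambda> l = lim (\<Delta> l)"

lemma \<Delta>_tendsto: "\<Delta> l \<longlonglongrightarrow> \<Lambda> l"
proof -
  have "convergent (\<lambda>i. shift z l i - z i)"
    using convergent_walk[of l] by (simp add: shift_def)
  then have "convergent (\<Delta> l)"
    unfolding \<Delta>_def by (simp add: reduction)
  then show ?thesis
    by (simp add: \<Lambda>_def convergent_LIMSEQ_iff)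
qed

text \<open>\<open>n\<close> is a time of the input and \<open>m\<close> one of the image: by
  \<open>m\<close> the effect of \<open>l\<close> has settled, jumps from \<open>n\<close> on act
  additively on top of \<open>l\<close>, and changes of the input from \<open>n\<close> on are not
  yet felt up to \<open>m\<close>.\<close>

definition good :: "real \<Rightarrow> (nat \<times> 'a) list \<Rightarrow> nat \<Rightarrow> nat \<Rightarrow> bool" where
  "good e l m n \<longleftrightarrow> (\<forall>p\<ge>m. NH (\<Delta> l p - \<Lambda> l) \<le> e) \<and>
     (\<forall>n'\<ge>n. \<forall>g\<in>D. \<forall>p. NH (\<Delta> ((n', g) # l) p - \<Delta> l p - \<Delta> [(n', g)] p) \<le> e) \<and>
     (\<forall>x\<in>\<Inter>k. T k. (\<forall>i<n. x i = shift z l i) \<longrightarrow> (\<forall>p\<le>m. NH (\<theta> x p - \<theta> (shift z l) p) \<le> e))"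

lemma \<theta>_agree_le:
  assumes "x \<in> (\<Inter>k. T k)" "e > 0"
  shows "\<forall>\<^sub>F n in sequentially. \<forall>y\<in>\<Inter>k. T k. (\<forall>i<n. y i = x i) \<longrightarrow> (\<forall>p\<le>m. NH (\<theta> y p - \<theta> x p) \<le> e)"
proof -
  have "\<forall>\<^sub>F n in sequentially. \<forall>y\<in>\<Inter>k. T k. (\<forall>i<n. y i = x i) \<longrightarrow> NH (\<theta> y p - \<theta> x p) \<le> e" for p
  proof -
    obtain n0 where n0: "\<And>y. y \<in> (\<Inter>k. T k) \<Longrightarrow> \<forall>i<n0. y i = x i \<Longrightarrow> NH (\<theta> y p - \<theta> x p) < e"
      using \<theta>_agree[OF assms, of p] by blast
    show ?thesis
      unfolding eventually_sequentially
    proof (intro exI[of _ n0] allI impI ballI)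
      fix n y assume "n \<ge> n0" "y \<in> (\<Inter>k. T k)" "\<forall>i<n. y i = x i"
      then show "NH (\<theta> y p - \<theta> x p) \<le> e"
        using n0[of y] by force
    qed
  qed
  then have "\<forall>\<^sub>F n in sequentially. \<forall>p\<in>{..m}. \<forall>y\<in>\<Inter>k. T k. (\<forall>i<n. y i = x i) \<longrightarrow> NH (\<theta> y p - \<theta> x p) \<le> e"
    by (intro eventually_ball_finite) auto
  then show ?thesis
    by eventually_elim auto
qed

lemma shift_Cons_agree: "i < n \<Longrightarrow> shift z ((n, g) # l) i = shift z l i"
  by (simp add: shift_def)

text \<open>Up to \<open>m\<close>, continuity of \<open>\<theta>\<close> at \<open>z\<close> and at
  \<open>shift z l\<close> costs \<open>e / 6\<close> each. After \<open>m\<close> the effect of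
  \<open>l\<close> hardly moves, whether it is applied to \<open>z\<close> or to \<open>y\<close>,
  so the estimate at \<open>m\<close> persists with two more errors of \<open>e / 3\<close>.
  Uniformity in \<open>g\<close> comes from \<open>y\<close> agreeing with \<open>z\<close> below
  \<open>n\<close> whatever \<open>g\<close> is.\<close>

lemma \<Delta>_Cons_approx:
  assumes l: "l \<in> \<Gamma>" and e: "e > 0"
  shows "\<forall>\<^sub>F n in sequentially. \<forall>g\<in>D. \<forall>p. NH (\<Delta> ((n, g) # l) p - \<Delta> l p - \<Delta> [(n, g)] p) \<le> e"
proof -
  obtain m n0 where mn: "\<And>y p q. y \<in> (\<Inter>k. T k) \<Longrightarrow> \<forall>i<n0. y i = z i \<Longrightarrow> p \<ge> m \<Longrightarrow> q \<ge> m \<Longrightarrow>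
      NH ((\<theta> (shift y l) p - \<theta> y p) - (\<theta> (shift y l) q - \<theta> y q)) \<le> e / 3"
    using tail_agree[OF l, of "e / 3"] e by (metis divide_pos_pos zero_less_numeral)
  have z: "z \<in> (\<Inter>k. T k)"
    using shift_generic[of "[]"] by simp
  have "\<forall>\<^sub>F n in sequentially. \<forall>y\<in>\<Inter>k. T k. (\<forall>i<n. y i = z i) \<longrightarrow> (\<forall>p\<le>m. NH (\<theta> y p - \<theta> z p) \<le> e / 6)"
    "\<forall>\<^sub>F n in sequentially. \<forall>y\<in>\<Inter>k. T k. (\<forall>i<n. y i = shift z l i) \<longrightarrow>
      (\<forall>p\<le>m. NH (\<theta> y p - \<theta> (shift z l) p) \<le> e / 6)"
    using e by (intro \<theta>_agree_le z shift_generic l; simp)+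
  then show ?thesis
    using eventually_ge_at_top[of n0]
  proof eventually_elim
    case (elim n)
    show ?case
    proof (intro ballI allI)
      fix g p assume g: "g \<in> D"
      define y where "y = shift z [(n, g)]"
      have y: "y \<in> (\<Inter>k. T k)"
        unfolding y_def by (rule shift_generic) (use g in auto)
      have yl: "shift y l = shift z ((n, g) # l)"
        by (simp add: y_def shift_shift_Cons)
      have sy: "shift y l \<in> (\<Inter>k. T k)"
        unfolding yl by (rule shift_generic) (use g l in auto)
      have y_agree: "\<forall>i<n. y i = z i"
        by (simp add: y_def shift_Cons_agree)
      have yl_agree: "\<forall>i<n. shift y l i = shift z l i"
        by (simp add: yl shift_Cons_agree)
      define u where "u q = \<theta> (shift y l) q - \<theta> y q" for q
      have u: "\<Delta> ((n, g) # l) q - \<Delta> [(n, g)] q = u q" for q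
        by (simp add: u_def \<Delta>_def yl flip: y_def)
      have low: "NH (u q - \<Delta> l q) \<le> e / 3" if "q \<le> m" for q
      proof -
        have "u q - \<Delta> l q = (\<theta> (shift y l) q - \<theta> (shift z l) q) - (\<theta> y q - \<theta> z q)"
          by (simp add: u_def \<Delta>_def)
        moreover have "NH (\<theta> y q - \<theta> z q) \<le> e / 6"
          using elim(1) y y_agree that by blast
        moreover have "NH (\<theta> (shift y l) q - \<theta> (shift z l) q) \<le> e / 6"
          using elim(2) sy yl_agree that by blast
        ultimately show ?thesis
          using H.diff_le[of "\<theta> (shift y l) q - \<theta> (shift z l) q" "\<theta> y q - \<theta> z q"] by simp
      qed
      have "NH (u p - \<Delta> l p) \<le> e"
      proof (cases "p \<le> m")
        case True
        then show ?thesis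
          using low[OF True] e by simp
      next
        case False
        have "NH (u p - u m) \<le> e / 3"
          unfolding u_def using y y_agree elim(3) False by (intro mn) auto
        moreover have "NH (\<Delta> l p - \<Delta> l m) \<le> e / 3"
          unfolding \<Delta>_def using z False by (intro mn) auto
        ultimately show ?thesis
          using low[of m] H.diff_triangle[of "u p" "\<Delta> l p" "u m"] H.diff_triangle[of "u m" "\<Delta> l p" "\<Delta> l m"]
            H.minus_commute[of "\<Delta> l p" "\<Delta> l m"] by simp
      qed
      moreover have "\<Delta> ((n, g) # l) p - \<Delta> l p - \<Delta> [(n, g)] p = u p - \<Delta> l p"
        using u[of p] by (simp add: algebra_simps)
      ultimately show "NH (\<Delta> ((n, g) # l) p - \<Delta> l p - \<Delta> [(n, g)] p) \<le> e"
        by (simp only:)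
    qed
  qed
qed

text \<open>The nesting matters: the third clause of \<open>good\<close> yields \<open>n\<close>
  only after \<open>m\<close> is fixed.\<close>

lemma eventually_good:
  assumes l: "l \<in> \<Gamma>" and e: "e > 0"
  shows "\<forall>\<^sub>F m in sequentially. \<forall>\<^sub>F n in sequentially. good e l m n"
proof -
  have "\<forall>\<^sub>F m in sequentially. \<forall>p\<ge>m. NH (\<Delta> l p - \<Lambda> l) \<le> e"
  proof -
    obtain M where M: "\<And>p. p \<ge> M \<Longrightarrow> NH (\<Delta> l p - \<Lambda> l) < e"
      using \<Delta>_tendsto[of l] e unfolding H.LIMSEQ_iff_N by blast
    show ?thesis
      unfolding eventually_sequentially
      using M by (intro exI[of _ M]) (meson less_imp_le order_trans)
  qed
  moreover obtain n0 where "\<forall>n'\<ge>n0. \<forall>g\<in>D. \<forall>p. NH (\<Delta> ((n', g) # l) p - \<Delta> l p - \<Delta> [(n', g)] p) \<le> e"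
    using \<Delta>_Cons_approx[OF assms] unfolding eventually_sequentially by blast
  then have "\<forall>\<^sub>F n in sequentially. \<forall>n'\<ge>n. \<forall>g\<in>D. \<forall>p. NH (\<Delta> ((n', g) # l) p - \<Delta> l p - \<Delta> [(n', g)] p) \<le> e"
    unfolding eventually_sequentially by (intro exI[of _ n0]) auto
  ultimately show ?thesis
    using \<theta>_agree_le[OF shift_generic[OF l] e]
    unfolding good_def by (auto elim!: eventually_mono simp: eventually_conj_iff)
qed

lemma good_mono: "good e l m n \<Longrightarrow> n \<le> n' \<Longrightarrow> good e l m n'"
  unfolding good_def by (meson less_le_trans order_trans)

text \<open>Along a sufficiently sparse sequence of jumps, the image under \<open>\<theta>\<close> changes by one jump at a time:
  on the block from \<open>m k\<close> to \<open>m (Suc k)\<close> only the k-th jump is felt.\<close>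

lemma fusion_one_sided:
  assumes n: "strict_mono n" and c: "\<And>k. c k \<in> D"
    and e: "\<And>k. e (Suc k) \<le> e k"
    and good1: "\<And>k. good (e k) (steps n c k) (m k) (n k)"
    and good2: "\<And>k. good (e k) [] (m k) (n k)"
    and good3: "\<And>k. good (e (Suc k)) [(n k, c k)] (m (Suc k)) (n (Suc k))"
    and T: "\<And>k x. \<forall>i<n k. x i = shift z (steps n c k) i \<Longrightarrow> x \<in> T k"
  defines "x \<equiv> \<lambda>i. z i + stretch n c i"
  shows "NH (\<theta> x (m k) - \<theta> z (m k) - \<Lambda> (steps n c k)) \<le> 2 * e k"
    and "m k \<le> p \<Longrightarrow> p \<le> m (Suc k) \<Longrightarrow>
           NH (\<theta> x p - \<theta> z p - \<Lambda> (steps n c k) - \<Delta> [(n k, c k)] p) \<le> 3 * e k"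
    and "NH (\<Lambda> (steps n c (Suc k)) - \<Lambda> (steps n c k) - \<Lambda> [(n k, c k)]) \<le> e k"
    and "p \<le> m k \<Longrightarrow> NH (\<Delta> [(n k, c k)] p) \<le> e k"
    and "p \<ge> m (Suc k) \<Longrightarrow> NH (\<Delta> [(n k, c k)] p - \<Lambda> [(n k, c k)]) \<le> e k"
proof -
  have agree: "x i = shift z (steps n c k) i" if "i < n k" for i k
    using stretch_eq[OF n that, of c] by (simp add: x_def shift_def walk_steps)
  \<comment> \<open>By stage \<open>k\<close> the point agrees with a finite walk for so long that
    membership in \<open>T k\<close> is decided.\<close>
  have x: "x \<in> (\<Inter>k. T k)"
    using T agree by blast
  have near: "NH (\<theta> x p - \<theta> (shift z (steps n c k)) p) \<le> e k" if "p \<le> m k" for p k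
    using good1[of k] x agree that unfolding good_def by blast
  have near\<Delta>: "NH (\<theta> x p - \<theta> z p - \<Delta> (steps n c k) p) \<le> e k" if "p \<le> m k" for p k
    using near[OF that] by (simp add: \<Delta>_def)
  have tail: "NH (\<Delta> (steps n c k) p - \<Lambda> (steps n c k)) \<le> e k" if "p \<ge> m k" for p k
    using good1[of k] that unfolding good_def by blast
  show "NH (\<theta> x (m k) - \<theta> z (m k) - \<Lambda> (steps n c k)) \<le> 2 * e k"
    using near\<Delta>[of "m k" k] tail[of k "m k"]
      H.diff_triangle[of "\<theta> x (m k) - \<theta> z (m k)" "\<Lambda> (steps n c k)" "\<Delta> (steps n c k) (m k)"] by simp
  have add: "NH (\<Delta> (steps n c (Suc k)) p - \<Delta> (steps n c k) p - \<Delta> [(n k, c k)] p) \<le> e k" for p k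
    using good1[of k] c[of k] unfolding good_def by simp
  show "NH (\<theta> x p - \<theta> z p - \<Lambda> (steps n c k) - \<Delta> [(n k, c k)] p) \<le> 3 * e k" if p: "m k \<le> p" "p \<le> m (Suc k)"
  proof -
    \<comment> \<open>Up to \<open>m (Suc k)\<close> the point \<open>x\<close> cannot be told from
      the walk with \<open>Suc k\<close> jumps; additivity splits off the last jump, and from
      \<open>m k\<close> on the earlier ones have settled.\<close>
    have "\<theta> x p - \<theta> z p - \<Lambda> (steps n c k) - \<Delta> [(n k, c k)] p =
      (\<theta> x p - \<theta> z p - \<Delta> (steps n c (Suc k)) p) +
      ((\<Delta> (steps n c (Suc k)) p - \<Delta> (steps n c k) p - \<Delta> [(n k, c k)] p) +
      (\<Delta> (steps n c k) p - \<Lambda> (steps n c k)))"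
      by (simp add: algebra_simps)
    also have "NH \<dots> \<le> e (Suc k) + (e k + e k)"
      using p by (intro order_trans[OF H.triangle] add_mono near\<Delta> add tail)
    finally show ?thesis
      using e[of k] by simp
  qed
  show "NH (\<Lambda> (steps n c (Suc k)) - \<Lambda> (steps n c k) - \<Lambda> [(n k, c k)]) \<le> e k"
  proof (rule LIMSEQ_le_const2)
    show "(\<lambda>p. NH (\<Delta> (steps n c (Suc k)) p - \<Delta> (steps n c k) p - \<Delta> [(n k, c k)] p)) \<longlonglongrightarrow>
      NH (\<Lambda> (steps n c (Suc k)) - \<Lambda> (steps n c k) - \<Lambda> [(n k, c k)])"
      by (rule continuous_on_tendsto_compose[OF H.continuous_on_N[of UNIV]])
         (auto intro!: tendsto_intros \<Delta>_tendsto)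
  qed (use add in blast)
  show "NH (\<Delta> [(n k, c k)] p) \<le> e k" if "p \<le> m k"
  proof -
    have "shift z [(n k, c k)] \<in> (\<Inter>k. T k)"
      by (rule shift_generic) (use c in auto)
    moreover have "\<forall>i<n k. shift z [(n k, c k)] i = shift z [] i"
      using shift_Cons_agree by blast
    ultimately have "NH (\<theta> (shift z [(n k, c k)]) p - \<theta> (shift z []) p) \<le> e k"
      using good2[of k] that unfolding good_def by blast
    then show ?thesis
      by (simp add: \<Delta>_def)
  qed
  show "NH (\<Delta> [(n k, c k)] p - \<Lambda> [(n k, c k)]) \<le> e k" if "p \<ge> m (Suc k)"
    using good3[of k] e[of k] that unfolding good_def by (meson order_trans)
qed

text \<open>Recursion on the list of choices made so far. \<open>Q k\<close> is met at arbitrarily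
  late times, so the next jump can be delayed until everything required of the finite walks has come
  into force.\<close>

lemma sparse_jumps:
  fixes Q :: "nat \<Rightarrow> (nat \<times> 'a \<times> 'a) set"
  assumes Q: "\<And>k M. \<exists>n a b. (n, a, b) \<in> Q k \<and> M \<le> n \<and> a \<in> D \<and> b \<in> D"
    and e: "\<And>k. e k > 0"
  obtains n m a b where "strict_mono n" "\<And>k. k \<le> m k" "\<And>k. (n k, a k, b k) \<in> Q k" "\<And>k. a k \<in> D" "\<And>k. b k \<in> D"
    "\<And>k l. l \<in> {steps n a k, steps n b k, [], take 1 (steps n a k), take 1 (steps n b k)} \<Longrightarrow> good (e k) l (m k) (n k)"
    "\<And>k x. \<forall>i<n k. x i = shift z (steps n a k) i \<Longrightarrow> x \<in> T k"
    "\<And>k x. \<forall>i<n k. x i = shift z (steps n b k) i \<Longrightarrow> x \<in> T k"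
proof -
  define la where "la L = map (\<lambda>(n, a, b). (n, a)) L" for L :: "(nat \<times> 'a \<times> 'a) list"
  define lb where "lb L = map (\<lambda>(n, a, b). (n, b)) L" for L :: "(nat \<times> 'a \<times> 'a) list"
  have la: "la L \<in> \<Gamma>" "take 1 (la L) \<in> \<Gamma>" and lb: "lb L \<in> \<Gamma>" "take 1 (lb L) \<in> \<Gamma>"
    if "L \<in> lists (UNIV \<times> D \<times> D)" for L
    using that by (induction L; auto simp: la_def lb_def)+
  \<comment> \<open>What the next jump waits for: \<open>m\<close> is the new image time,
    \<open>M\<close> a threshold for the jump time. \<open>take 1\<close> is the latest jump alone,
    whose effect must have settled by the end of its block. The last conjunct makes \<open>n\<close>
    strictly increasing, and \<open>length L \<le> m\<close> drives the image times to
    infinity.\<close>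
  define P where "P L m M \<longleftrightarrow> length L \<le> m \<and>
      (\<forall>l \<in> {la L, lb L, [], take 1 (la L), take 1 (lb L)}. good (e (length L)) l m M) \<and>
      (\<forall>x. (\<forall>i<M. x i = shift z (la L) i) \<longrightarrow> x \<in> T (length L)) \<and>
      (\<forall>x. (\<forall>i<M. x i = shift z (lb L) i) \<longrightarrow> x \<in> T (length L)) \<and>
      (\<forall>y\<in>set L. fst y < M)" for L m M
  have "\<exists>m M. P L m M" if L: "L \<in> lists (UNIV \<times> D \<times> D)" for L
  proof -
    have "\<forall>\<^sub>F m in sequentially. \<forall>l \<in> {la L, lb L, [], take 1 (la L), take 1 (lb L)}.
        \<forall>\<^sub>F M in sequentially. good (e (length L)) l m M"
      using la[OF L] lb[OF L] e by (intro eventually_ball_finite ballI eventually_good) auto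
    then have "\<forall>\<^sub>F m in sequentially. length L \<le> m \<and> (\<forall>l \<in> {la L, lb L, [], take 1 (la L), take 1 (lb L)}.
        \<forall>\<^sub>F M in sequentially. good (e (length L)) l m M)"
      using eventually_ge_at_top[of "length L"] by eventually_elim simp
    then obtain m where m: "length L \<le> m" "\<And>l. l \<in> {la L, lb L, [], take 1 (la L), take 1 (lb L)} \<Longrightarrow>
        \<forall>\<^sub>F M in sequentially. good (e (length L)) l m M"
      using eventually_happens'[OF sequentially_bot] by blast
    have T: "\<forall>\<^sub>F M in sequentially. \<forall>x. (\<forall>i<M. x i = shift z l i) \<longrightarrow> x \<in> T (length L)" if l: "l \<in> \<Gamma>" for l
    proof -
      obtain n where "\<forall>y. (\<forall>i<n. y i = shift z l i) \<longrightarrow> y \<in> T (length L)"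
        using T_agree[of "shift z l" "length L"] shift_generic[OF l] by blast
      then show ?thesis
        unfolding eventually_sequentially by (intro exI[of _ n]) (meson less_le_trans)
    qed
    have "\<forall>\<^sub>F M in sequentially. \<forall>l \<in> {la L, lb L, [], take 1 (la L), take 1 (lb L)}. good (e (length L)) l m M"
      using m by (intro eventually_ball_finite) auto
    moreover have "\<forall>\<^sub>F M in sequentially. \<forall>y\<in>set L. fst y < M"
      using eventually_gt_at_top by (intro eventually_ball_finite) auto
    ultimately have "\<forall>\<^sub>F M in sequentially. P L m M"
      using T[OF la(1)[OF L]] T[OF lb(1)[OF L]]
    proof eventually_elim
      case (elim M)
      then show ?case
        unfolding P_def using m(1) by blast
    qed
    then show ?thesis
      using eventually_happens'[OF sequentially_bot] by blast
  qed
  then obtain \<mu> \<nu> where \<mu>\<nu>: "\<And>L. L \<in> lists (UNIV \<times> D \<times> D) \<Longrightarrow> P L (\<mu> L) (\<nu> L)"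
    by metis
  obtain q where q: "\<And>k M. q k M \<in> Q k \<and> M \<le> fst (q k M) \<and> q k M \<in> UNIV \<times> D \<times> D"
  proof -
    have "\<forall>k M. \<exists>y. y \<in> Q k \<and> M \<le> fst y \<and> y \<in> UNIV \<times> D \<times> D"
      using Q by fastforce
    then show ?thesis
      using that by metis
  qed
  define St where "St = rec_nat [] (\<lambda>k L. q k (\<nu> L) # L)"
  have St_simps: "St 0 = []" "St (Suc k) = q k (\<nu> (St k)) # St k" for k
    by (simp_all add: St_def)
  have St: "St k \<in> lists (UNIV \<times> D \<times> D)" "length (St k) = k" for k
    using q by (induction k) (auto simp: St_simps simp del: mem_Sigma_iff)
  define y where "y k = q k (\<nu> (St k))" for k
  define n a b where "n k = fst (y k)" and "a k = fst (snd (y k))" and "b k = snd (snd (y k))" for k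
  have y_eq: "y k = (n k, a k, b k)" for k
    by (simp add: n_def a_def b_def)
  have ya: "la (St k) = steps n a k" "lb (St k) = steps n b k" for k
    by (induction k) (simp_all add: la_def lb_def St_simps y_eq flip: y_def)
  have n_ge: "\<nu> (St k) \<le> n k" for k
    using q by (simp add: n_def y_def)
  have P: "P (St k) (\<mu> (St k)) (\<nu> (St k))" for k
    by (rule \<mu>\<nu>[OF St(1)])
  have yS: "y j \<in> set (St k)" if "j < k" for j k
    using that by (induction k) (auto simp: St_simps less_Suc_eq simp flip: y_def)
  show ?thesis
  proof (rule that[of n "\<lambda>k. \<mu> (St k)" a b])
    show "strict_mono n"
    proof (rule strict_monoI)
      fix i j :: nat assume "i < j"
      then have "fst (y i) < \<nu> (St j)"
        using P[of j] yS unfolding P_def by blast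
      then show "n i < n j"
        using n_ge[of j] by (simp add: n_def)
    qed
    show "k \<le> \<mu> (St k)" for k
      using P[of k] St(2)[of k] unfolding P_def by simp
    have "y k \<in> Q k" "y k \<in> UNIV \<times> D \<times> D" for k
      using q unfolding y_def by blast+
    then show "(n k, a k, b k) \<in> Q k" "a k \<in> D" "b k \<in> D" for k
      using y_eq by (metis, metis SigmaE2, metis SigmaE2)
    show "good (e k) l (\<mu> (St k)) (n k)"
      if "l \<in> {steps n a k, steps n b k, [], take 1 (steps n a k), take 1 (steps n b k)}" for k l
      using P[of k] St(2)[of k] that unfolding P_def ya by (metis good_mono n_ge)
    show "x \<in> T k" if "\<forall>i<n k. x i = shift z (steps n a k) i" for k x
      using P[of k] St(2)[of k] that n_ge[of k] unfolding P_def ya by (metis less_le_trans)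
    show "x \<in> T k" if "\<forall>i<n k. x i = shift z (steps n b k) i" for k x
      using P[of k] St(2)[of k] that n_ge[of k] unfolding P_def ya by (metis less_le_trans)
  qed
qed

text \<open>The only consequence of the Borel reduction used from here on.\<close>

theorem fusion:
  fixes Q :: "nat \<Rightarrow> (nat \<times> 'a \<times> 'a) set"
  assumes Q: "\<And>k M. \<exists>n a b. (n, a, b) \<in> Q k \<and> M \<le> n \<and> a \<in> D \<and> b \<in> D"
  obtains n a b where "strict_mono n" "\<And>k. (n k, a k, b k) \<in> Q k" "\<And>k. a k \<in> D" "\<And>k. b k \<in> D"
    "summable (\<lambda>k. a k - b k) \<longleftrightarrow>
       summable (\<lambda>k. \<Lambda> [(n k, a k)] - \<Lambda> [(n k, b k)]) \<and>
       (\<forall>e>0. \<exists>K. \<forall>k\<ge>K. \<forall>p. NH (\<Delta> [(n k, a k)] p - \<Delta> [(n k, b k)] p) \<le> e)"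
proof -
  \<comment> \<open>Geometric errors are summable, so they do not affect the convergence of a
    series.\<close>
  define e :: "nat \<Rightarrow> real" where "e k = (1/2) ^ k" for k
  have e_pos: "e k > 0" and e_dec: "e (Suc k) \<le> e k" for k
    by (simp_all add: e_def)
  have e_tendsto: "e \<longlonglongrightarrow> 0"
    unfolding e_def by (rule LIMSEQ_realpow_zero) auto
  have e_small: "\<exists>K. \<forall>k\<ge>K. e k \<le> d" if "d > 0" for d
    using order_tendstoD(2)[OF e_tendsto that] unfolding eventually_sequentially by (meson less_imp_le)
  obtain n m a b where n: "strict_mono n" and m: "\<And>k. k \<le> m k" and nQ: "\<And>k. (n k, a k, b k) \<in> Q k"
    and a: "\<And>k. a k \<in> D" and b: "\<And>k. b k \<in> D"
    and good: "\<And>k l. l \<in> {steps n a k, steps n b k, [], take 1 (steps n a k), take 1 (steps n b k)} \<Longrightarrow> good (e k) l (m k) (n k)"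
    and Ta: "\<And>k x. \<forall>i<n k. x i = shift z (steps n a k) i \<Longrightarrow> x \<in> T k"
    and Tb: "\<And>k x. \<forall>i<n k. x i = shift z (steps n b k) i \<Longrightarrow> x \<in> T k"
    by (rule sparse_jumps[of Q e, OF Q e_pos]) (rule that; assumption)
  \<comment> \<open>At index \<open>Suc k\<close>, \<open>take 1\<close> of the steps is the jump
    with index \<open>k\<close>.\<close>
  have "good (e (Suc k)) [(n k, a k)] (m (Suc k)) (n (Suc k))" "good (e (Suc k)) [(n k, b k)] (m (Suc k)) (n (Suc k))" for k
    using good[of _ "Suc k"] by simp_all
  note sa = fusion_one_sided[of n a e m, OF n a e_dec good good this(1) Ta, simplified]
    and sb = fusion_one_sided[of n b e m, OF n b e_dec good good this(2) Tb, simplified]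
  \<comment> \<open>On the block from \<open>m k\<close> to \<open>m (Suc k)\<close>,
    \<open>y\<close> is about \<open>E k\<close>, the settled effect of the earlier jumps, plus the
    transient \<open>\<rho> k\<close>, which runs from about 0 to about \<open>\<sigma> k\<close>.
    Hence \<open>y\<close> converges iff \<open>E\<close> does and the transients vanish uniformly;
    up to a summable error, \<open>E\<close> consists of the partial sums of
    \<open>\<sigma>\<close>.\<close>
  define y where "y p = \<theta> (\<lambda>i. z i + stretch n a i) p - \<theta> (\<lambda>i. z i + stretch n b i) p" for p
  define E where "E k = \<Lambda> (steps n a k) - \<Lambda> (steps n b k)" for k
  define \<sigma> where "\<sigma> k = \<Lambda> [(n k, a k)] - \<Lambda> [(n k, b k)]" for k
  define \<rho> where "\<rho> k p = \<Delta> [(n k, a k)] p - \<Delta> [(n k, b k)] p" for k p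
  have comb: "NH (u - v) \<le> 2 * d" if "NH u \<le> d" "NH v \<le> d" for u v d
    using H.diff_le[of u v] that by simp
  have y_m: "NH (y (m k) - E k) \<le> 4 * e k" for k
    using comb[OF sa(1)[of k] sb(1)[of k]] by (simp add: y_def E_def algebra_simps)
  have y_block: "NH (y p - E k - \<rho> k p) \<le> 6 * e k" if "m k \<le> p" "p \<le> m (Suc k)" for k p
    using comb[OF sa(2)[OF that] sb(2)[OF that]] by (simp add: y_def E_def \<rho>_def algebra_simps)
  have E_Suc: "NH (E (Suc k) - E k - \<sigma> k) \<le> 2 * e k" for k
    using comb[OF sa(3)[of k] sb(3)[of k]] by (simp add: E_def \<sigma>_def algebra_simps)
  have \<rho>_low: "NH (\<rho> k p) \<le> 2 * e k" if "p \<le> m k" for k p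
    using comb[OF sa(4)[OF that] sb(4)[OF that]] by (simp add: \<rho>_def)
  have \<rho>_high: "NH (\<rho> k p - \<sigma> k) \<le> 2 * e k" if "p \<ge> m (Suc k)" for k p
    using comb[OF sa(5)[OF that] sb(5)[OF that]] by (simp add: \<rho>_def \<sigma>_def algebra_simps)
  have "convergent y \<longleftrightarrow> convergent (\<lambda>i. (z i + stretch n a i) - (z i + stretch n b i))"
    unfolding y_def by (rule reduction[symmetric])
  also have "(\<lambda>i. (z i + stretch n a i) - (z i + stretch n b i)) = stretch n (\<lambda>k. a k - b k)"
    by (simp add: fun_eq_iff flip: stretch_diff)
  finally have conv_y: "convergent y \<longleftrightarrow> summable (\<lambda>k. a k - b k)"
    by (simp add: convergent_stretch_iff[OF n])
  have "summable (\<lambda>k. E (Suc k) - E k - \<sigma> k)"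
    by (rule H.summable_comparison_N[OF _ E_Suc]) (auto simp: e_def intro!: summable_mult summable_geometric)
  then have conv_err: "convergent (\<lambda>k. \<Sum>i<k. E (Suc i) - E i - \<sigma> i)"
    by (simp add: summable_iff_convergent)
  have sum_eq: "(\<Sum>i<k. \<sigma> i) = E k - E 0 - (\<Sum>i<k. E (Suc i) - E i - \<sigma> i)" for k
    by (induction k) (simp_all add: algebra_simps)
  have conv_E: "convergent E \<longleftrightarrow> summable \<sigma>"
  proof
    assume "convergent E"
    then have "convergent (\<lambda>k. E k - E 0 - (\<Sum>i<k. E (Suc i) - E i - \<sigma> i))"
      by (intro convergent_diff conv_err convergent_const)
    then show "summable \<sigma>"
      by (simp add: summable_iff_convergent flip: sum_eq)
  next
    assume "summable \<sigma>"
    then have "convergent (\<lambda>k. (\<Sum>i<k. \<sigma> i) - (- E 0 - (\<Sum>i<k. E (Suc i) - E i - \<sigma> i)))"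
      by (intro convergent_diff conv_err convergent_const) (simp add: summable_iff_convergent)
    moreover have "(\<Sum>i<k. \<sigma> i) - (- E 0 - (\<Sum>i<k. E (Suc i) - E i - \<sigma> i)) = E k" for k
      by (simp only: sum_eq) (simp add: algebra_simps)
    ultimately show "convergent E"
      by simp
  qed
  have "convergent y \<longleftrightarrow> summable \<sigma> \<and> (\<forall>d>0. \<exists>K. \<forall>k\<ge>K. \<forall>p. NH (\<rho> k p) \<le> d)"
  proof
    assume y: "convergent y"
    have "filterlim m at_top sequentially"
      by (rule filterlim_at_top_mono[OF filterlim_ident]) (use m in auto)
    then have "convergent (\<lambda>k. y (m k))"
      using y unfolding convergent_def by (auto intro: filterlim_compose)
    moreover have "(\<lambda>k. y (m k) - E k) \<longlonglongrightarrow> 0"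
    proof -
      have "(\<lambda>k. NH (y (m k) - E k - 0)) \<longlonglongrightarrow> 0"
        by (rule Lim_null_comparison[OF _ tendsto_mult_right_zero[OF e_tendsto, of 4]])
           (simp add: y_m H.nonneg)
      then show ?thesis
        by (subst H.tendsto_iff_N)
    qed
    then have "convergent (\<lambda>k. y (m k) - E k)"
      by (auto simp: convergent_def)
    ultimately have "convergent (\<lambda>k. y (m k) - (y (m k) - E k))"
      by (rule convergent_diff)
    then have "summable \<sigma>"
      using conv_E by simp
    moreover have "\<exists>K. \<forall>k\<ge>K. \<forall>p. NH (\<rho> k p) \<le> d" if d: "d > 0" for d
    proof -
      obtain M where M: "\<And>p q. p \<ge> M \<Longrightarrow> q \<ge> M \<Longrightarrow> NH (y p - y q) \<le> d / 2"
        using H.convergent_imp_N_Cauchy[OF y, of "d / 2"] d by (metis half_gt_zero)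
      obtain K where K: "\<And>k. k \<ge> K \<Longrightarrow> e k \<le> d / 32"
        using e_small[of "d / 32"] d by auto
      have "NH (\<rho> k p) \<le> d" if k: "k \<ge> max K M" for k p
      proof -
        have ek: "e k \<le> d / 32" "e (Suc k) \<le> d / 32"
          using K k by auto
        have mk: "m k \<ge> M" "m (Suc k) \<ge> M"
          using m[of k] m[of "Suc k"] k by auto
        \<comment> \<open>Before the block the transient is negligible; inside, it is an increment
          of \<open>y\<close>; afterwards it is close to \<open>\<sigma> k\<close>, an increment of
          \<open>y\<close> between the ends of the block. At most \<open>12 * e k\<close> is lost,
          which fits into the remaining \<open>d / 2\<close>.\<close>
        consider "p \<le> m k" | "m k \<le> p" "p \<le> m (Suc k)" | "m (Suc k) \<le> p"
          by linarith
        then show ?thesis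
        proof cases
          case 1
          then show ?thesis
            using \<rho>_low[OF 1] ek d by simp
        next
          case 2
          have "\<rho> k p = (y p - y (m k)) + ((y (m k) - E k) - (y p - E k - \<rho> k p))"
            by (simp add: algebra_simps)
          also have "NH \<dots> \<le> d / 2 + (4 * e k + 6 * e k)"
            using 2 mk
            by (intro order_trans[OF H.triangle] add_mono M order_trans[OF H.diff_le] y_m y_block) auto
          finally show ?thesis
            using ek d by simp
        next
          case 3
          have "\<rho> k p = (\<rho> k p - \<sigma> k) + ((y (m (Suc k)) - y (m k)) + ((y (m k) - E k) -
              ((y (m (Suc k)) - E (Suc k)) + (E (Suc k) - E k - \<sigma> k))))"
            by (simp add: algebra_simps)
          also have "NH \<dots> \<le> 2 * e k + (d / 2 + (4 * e k + (4 * e (Suc k) + 2 * e k)))"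
            using 3 mk
            by (intro order_trans[OF H.triangle] add_mono M order_trans[OF H.diff_le] y_m E_Suc \<rho>_high) auto
          finally show ?thesis
            using ek d by simp
        qed
      qed
      then show ?thesis
        by blast
    qed
    ultimately show "summable \<sigma> \<and> (\<forall>d>0. \<exists>K. \<forall>k\<ge>K. \<forall>p. NH (\<rho> k p) \<le> d)"
      by blast
  next
    assume *: "summable \<sigma> \<and> (\<forall>d>0. \<exists>K. \<forall>k\<ge>K. \<forall>p. NH (\<rho> k p) \<le> d)"
    then obtain l where l: "E \<longlonglongrightarrow> l"
      using conv_E by (auto simp: convergent_def)
    have "y \<longlonglongrightarrow> l"
      unfolding H.LIMSEQ_iff_N
    proof (intro allI impI)
      fix d :: real assume d: "d > 0"
      obtain K1 where K1: "\<And>k. k \<ge> K1 \<Longrightarrow> NH (E k - l) < d / 4"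
        using l d unfolding H.LIMSEQ_iff_N by (meson divide_pos_pos zero_less_numeral)
      obtain K2 where K2: "\<And>k p. k \<ge> K2 \<Longrightarrow> NH (\<rho> k p) \<le> d / 4"
        using * d by (meson divide_pos_pos zero_less_numeral)
      obtain K3 where K3: "\<And>k. k \<ge> K3 \<Longrightarrow> e k \<le> d / 24"
        using e_small[of "d / 24"] d by auto
      define K where "K = max K1 (max K2 K3)"
      \<comment> \<open>\<open>m\<close> is not known to be monotone, so \<open>p\<close> has to
        pass each of \<open>m 0\<close>, ..., \<open>m K\<close> before the block found for it has
        index at least \<open>K\<close>.\<close>
      have "NH (y p - l) < d" if p: "p \<ge> Max (m ` {..K})" for p
      proof -
        have p: "m j \<le> p" if "j \<le> K" for j
          using p that by (meson Max_ge atMost_iff finite_atMost finite_imageI imageI order_trans)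
        define k where "k = (LEAST k. p < m (Suc k))"
        have "p < m (Suc p)"
          using m[of "Suc p"] by simp
        then have k: "p < m (Suc k)"
          unfolding k_def by (rule LeastI)
        have kK: "k \<ge> K"
          using k p[of "Suc k"] by (meson not_less not_less_eq_eq)
        have "m k \<le> p"
        proof (cases k)
          case 0
          then show ?thesis
            using p[of 0] by simp
        next
          case (Suc j)
          then show ?thesis
            using not_less_Least[of j "\<lambda>k. p < m (Suc k)"] unfolding k_def by simp
        qed
        have "y p - l = (y p - E k - \<rho> k p) + (\<rho> k p + (E k - l))"
          by (simp add: algebra_simps)
        also have "NH \<dots> \<le> 6 * e k + (d / 4 + d / 4)"
          using \<open>m k \<le> p\<close> k kK
          by (intro order_trans[OF H.triangle] add_mono y_block K2 less_imp_le[OF K1]) (auto simp: K_def)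
        finally show ?thesis
          using K3[of k] kK d by (simp add: K_def)
      qed
      then show "\<exists>M. \<forall>p\<ge>M. NH (y p - l) < d"
        by blast
    qed
    then show "convergent y"
      by (auto simp: convergent_def)
  qed
  moreover have "\<sigma> = (\<lambda>k. \<Lambda> [(n k, a k)] - \<Lambda> [(n k, b k)])"
    by (simp add: fun_eq_iff \<sigma>_def)
  ultimately show ?thesis
    using conv_y n nQ a b by (intro that[of n a b]) (simp_all add: \<rho>_def)
qed

end

section \<open>The limit homomorphism\<close>

text \<open>The finite paths are laid end to end. Reflexivity at \<open>c k\<close> rules out empty
  paths, which would keep \<open>K\<close> from increasing strictly.\<close>

lemma walk_through:
  fixes c :: "nat \<Rightarrow> 'c"
  assumes path: "\<And>k. (R k)\<^sup>*\<^sup>* (c k) (c (Suc k))" and refl: "\<And>k. R k (c k) (c k)"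
  obtains u K where "strict_mono K" "K 0 = 0" "\<And>k. u (K k) = c k"
    "\<And>k j. K k \<le> j \<Longrightarrow> \<exists>i\<ge>k. R i (u j) (u (Suc j))"
proof -
  have "\<exists>n>0. \<exists>f. f 0 = c k \<and> f n = c (Suc k) \<and> (\<forall>i<n. R k (f i) (f (Suc i)))" for k
  proof -
    have "(R k)\<^sup>+\<^sup>+ (c k) (c (Suc k))"
      using path refl by (metis rtranclp_into_tranclp2)
    then show ?thesis
      by (auto simp: tranclp_power relpowp_fun_conv)
  qed
  then obtain n f where n: "\<And>k. n k > 0" and f: "\<And>k. f k 0 = c k" "\<And>k. f k (n k) = c (Suc k)"
    "\<And>k i. i < n k \<Longrightarrow> R k (f k i) (f k (Suc i))"
    by metis
  define K where "K k = (\<Sum>i<k. n i)" for k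
  have K_Suc: "K (Suc k) = K k + n k" for k
    by (simp add: K_def)
  have K: "strict_mono K"
    using n by (simp add: strict_mono_Suc_iff K_Suc)
  define \<kappa> where "\<kappa> j = (LEAST k. j < K (Suc k))" for j
  have \<kappa>: "K (\<kappa> j) \<le> j \<and> j < K (Suc (\<kappa> j))" for j
  proof -
    have "j < K (Suc j)"
      using strict_mono_imp_increasing[OF K, of "Suc j"] by simp
    then have *: "j < K (Suc (\<kappa> j))"
      unfolding \<kappa>_def by (rule LeastI)
    show ?thesis
    proof (cases "\<kappa> j")
      case 0
      then show ?thesis
        using * by (simp add: K_def)
    next
      case (Suc i)
      then show ?thesis
        using * not_less_Least[of i "\<lambda>k. j < K (Suc k)"] unfolding \<kappa>_def by simp
    qed
  qed
  have \<kappa>_eq: "\<kappa> j = k" if "K k \<le> j" "j < K (Suc k)" for j k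
  proof -
    have "k < Suc (\<kappa> j)" "\<kappa> j < Suc k"
      using that \<kappa>[of j] K by (meson le_less_trans strict_mono_less)+
    then show ?thesis
      by simp
  qed
  define u where "u j = f (\<kappa> j) (j - K (\<kappa> j))" for j
  have u: "u j = f k (j - K k)" if "K k \<le> j" "j < K (Suc k)" for j k
    using \<kappa>_eq[OF that] by (simp add: u_def)
  have uK: "u (K k) = c k" for k
    using u[of k "K k"] n[of k] f(1) by (simp add: K_Suc)
  show ?thesis
  proof (rule that[OF K _ uK])
    show "K 0 = 0"
      by (simp add: K_def)
  next
    fix k j assume "K k \<le> j"
    then have "k < Suc (\<kappa> j)"
      using \<kappa>[of j] K by (meson le_less_trans strict_mono_less)
    moreover have "R (\<kappa> j) (u j) (u (Suc j))"
    proof -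
      have "u (Suc j) = f (\<kappa> j) (Suc (j - K (\<kappa> j)))"
      \<comment> \<open>The last step of a path ends where the next path starts, and there the block
        number changes.\<close>
      proof (cases "Suc j < K (Suc (\<kappa> j))")
        case True
        then show ?thesis
          using u[of "\<kappa> j" "Suc j"] \<kappa>[of j] by (simp add: Suc_diff_le)
      next
        case False
        then have "Suc j = K (Suc (\<kappa> j))"
          using \<kappa>[of j] by simp
        then have "u (Suc j) = c (Suc (\<kappa> j))" "Suc (j - K (\<kappa> j)) = n (\<kappa> j)"
          using \<kappa>[of j] K_Suc[of "\<kappa> j"] uK[of "Suc (\<kappa> j)"] by simp_all
        then show ?thesis
          by (simp add: f(2))
      qed
      moreover have "j - K (\<kappa> j) < n (\<kappa> j)"
        using \<kappa>[of j] K_Suc[of "\<kappa> j"] by arith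
      ultimately show ?thesis
        using f(3) u[of "\<kappa> j" j] \<kappa>[of j] by simp
    qed
    ultimately show "\<exists>i\<ge>k. R i (u j) (u (Suc j))"
      by (meson less_Suc_eq_le)
  qed
qed

section \<open>Equicontinuity of the jump maps\<close>

context generic_reduction
begin

lemma zero_in_D [simp]: "0 \<in> D"
  and add_in_D: "x \<in> D \<Longrightarrow> y \<in> D \<Longrightarrow> x + y \<in> D"
  and minus_in_D: "x \<in> D \<Longrightarrow> - x \<in> D"
  using subgroup_D by (auto simp: is_subgroup_def)

lemma diff_in_D: "x \<in> D \<Longrightarrow> y \<in> D \<Longrightarrow> x - y \<in> D"
  using add_in_D[of x "- y"] minus_in_D[of y] by simp

lemma \<Delta>_zero [simp]: "\<Delta> [(n, 0)] p = 0"
proof -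
  have "shift z [(n, 0)] = z"
    by (simp add: fun_eq_iff shift_def)
  then show ?thesis
    by (simp add: \<Delta>_def)
qed

lemma \<Lambda>_zero [simp]: "\<Lambda> [(n, 0)] = 0"
proof -
  have "\<Delta> [(n, 0)] = (\<lambda>_. 0)"
    by (simp add: fun_eq_iff)
  then have "\<Delta> [(n, 0)] \<longlonglongrightarrow> 0"
    by simp
  then show ?thesis
    using \<Delta>_tendsto LIMSEQ_unique by blast
qed

text \<open>Otherwise pairs with \<open>NG (a - b) < (1/2) ^ k\<close> and a large transient occur
  at arbitrarily late times. Fusing them gives a convergent series, and the reduction forces its
  transients to vanish uniformly. The bound covers every \<open>p\<close>, since
  \<open>summable_if_summable_S\<close> again has to control transients.\<close>

lemma equicontinuous_\<Delta>:
  assumes "e > 0"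
  shows "\<exists>d>0. \<exists>M. \<forall>n\<ge>M. \<forall>a\<in>D. \<forall>b\<in>D. NG (a - b) < d \<longrightarrow> (\<forall>p. NH (\<Delta> [(n, a)] p - \<Delta> [(n, b)] p) \<le> e)"
proof (rule ccontr)
  assume "\<not> ?thesis"
  then have neg: "\<exists>n\<ge>M. \<exists>a\<in>D. \<exists>b\<in>D. NG (a - b) < d \<and> (\<exists>p. \<not> NH (\<Delta> [(n, a)] p - \<Delta> [(n, b)] p) \<le> e)"
    if "d > 0" for d M
    using that by meson
  define Q where "Q k = {(n, a, b). NG (a - b) < (1/2) ^ k \<and> (\<exists>p. \<not> NH (\<Delta> [(n, a)] p - \<Delta> [(n, b)] p) \<le> e)}"
    for k :: nat
  have Q: "\<exists>n a b. (n, a, b) \<in> Q k \<and> M \<le> n \<and> a \<in> D \<and> b \<in> D" for k M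
    using neg[of "(1/2)^k" M] unfolding Q_def by auto
  obtain n a b where nQ: "\<And>k. (n k, a k, b k) \<in> Q k"
    and fus: "summable (\<lambda>k. a k - b k) \<longleftrightarrow>
       summable (\<lambda>k. \<Lambda> [(n k, a k)] - \<Lambda> [(n k, b k)]) \<and>
       (\<forall>e>0. \<exists>K. \<forall>k\<ge>K. \<forall>p. NH (\<Delta> [(n k, a k)] p - \<Delta> [(n k, b k)] p) \<le> e)"
    by (rule fusion[of Q, OF Q]) (rule that; assumption)
  have "summable (\<lambda>k. a k - b k)"
    by (rule G.summable_comparison_N[of "\<lambda>k. (1/2) ^ k"])
       (use nQ in \<open>auto simp: Q_def less_imp_le intro!: summable_geometric\<close>)
  then obtain K where "\<forall>p. NH (\<Delta> [(n K, a K)] p - \<Delta> [(n K, b K)] p) \<le> e"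
    using fus assms by blast
  then show False
    using nQ[of K] by (auto simp: Q_def)
qed

lemma equicontinuous_\<Lambda>:
  assumes "e > 0"
  obtains d M where "d > 0"
    "\<And>n a b. n \<ge> M \<Longrightarrow> a \<in> D \<Longrightarrow> b \<in> D \<Longrightarrow> NG (a - b) < d \<Longrightarrow> NH (\<Lambda> [(n, a)] - \<Lambda> [(n, b)]) \<le> e"
proof -
  obtain d M where d: "d > 0" and M:
    "\<And>n a b p. n \<ge> M \<Longrightarrow> a \<in> D \<Longrightarrow> b \<in> D \<Longrightarrow> NG (a - b) < d \<Longrightarrow> NH (\<Delta> [(n, a)] p - \<Delta> [(n, b)] p) \<le> e"
    using equicontinuous_\<Delta>[OF assms] by blast
  show ?thesis
  proof (rule that[OF d])
    fix n a b assume *: "n \<ge> M" "a \<in> D" "b \<in> D" "NG (a - b) < d"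
    show "NH (\<Lambda> [(n, a)] - \<Lambda> [(n, b)]) \<le> e"
    proof (rule LIMSEQ_le_const2)
      show "(\<lambda>p. NH (\<Delta> [(n, a)] p - \<Delta> [(n, b)] p)) \<longlonglongrightarrow> NH (\<Lambda> [(n, a)] - \<Lambda> [(n, b)])"
        by (rule continuous_on_tendsto_compose[OF H.continuous_on_N[of UNIV]])
           (auto intro!: tendsto_intros \<Delta>_tendsto)
    qed (use M * in blast)
  qed
qed

end

section \<open>Compactness and the limit map on \<open>D\<close>\<close>

locale dense_generic_reduction = generic_reduction +
  assumes countable_D: "countable D"
    and D_subset: "D \<subseteq> identity_component"
    and D_dense: "identity_component \<subseteq> closure D"
begin

lemma D_approx:
  assumes "x \<in> identity_component" "e > 0"
  obtains d where "d \<in> D" "NG (d - x) < e"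
proof -
  have "x \<in> closure D"
    using assms D_dense by blast
  moreover have "open {y. NG (y - x) < e}" "x \<in> {y. NG (y - x) < e}"
    using assms G.open_N_ball by auto
  ultimately have "D \<inter> {y. NG (y - x) < e} \<noteq> {}"
    by (metis IntI closure_iff_nhds_not_empty empty_iff inf_commute subset_refl)
  then show ?thesis
    using that by blast
qed

text \<open>Near each point of the component, elements of \<open>D\<close> are linked by a single
  step; connectedness and density make this global.\<close>

lemma chain_in_D:
  assumes "g \<in> D" "h \<in> D" "e > 0"
  shows "(\<lambda>x y. x \<in> D \<and> y \<in> D \<and> NG (y - x) < e)\<^sup>*\<^sup>* g h"
proof (rule connected_equivalence_relation_gen[where S = identity_component and P = "\<lambda>x. x \<in> D"])
  show "connected (identity_component :: 'a set)"
    by (simp add: identity_component_def)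
  show "\<exists>w. w \<in> U \<and> w \<in> D" if U: "openin (top_of_set identity_component) U" "a \<in> U" for U a
  proof -
    obtain V where V: "open V" "U = identity_component \<inter> V"
      using U(1) by (auto simp: openin_open)
    then have "a \<in> closure D"
      using U(2) D_dense by blast
    then have "V \<inter> D \<noteq> {}"
      using open_Int_closure_eq_empty[OF V(1), of D] U(2) V(2) by blast
    then show ?thesis
      using V(2) D_subset by blast
  qed
  show "\<exists>U. openin (top_of_set identity_component) U \<and> a \<in> U \<and>
      (\<forall>x\<in>U. \<forall>y\<in>U. x \<in> D \<and> y \<in> D \<longrightarrow> (\<lambda>x y. x \<in> D \<and> y \<in> D \<and> NG (y - x) < e)\<^sup>*\<^sup>* x y)"
    if "a \<in> identity_component" for a
  proof (intro exI[of _ "identity_component \<inter> {x. NG (x - a) < e / 2}"] conjI ballI impI)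
    show "openin (top_of_set identity_component) (identity_component \<inter> {x. NG (x - a) < e / 2})"
      by (intro openin_open_Int G.open_N_ball)
    show "a \<in> identity_component \<inter> {x. NG (x - a) < e / 2}"
      using that assms by simp
    fix x y assume *: "x \<in> identity_component \<inter> {x. NG (x - a) < e / 2}"
      "y \<in> identity_component \<inter> {x. NG (x - a) < e / 2}" "x \<in> D \<and> y \<in> D"
    then have "NG (y - x) < e"
      using G.diff_triangle[of y x a] G.minus_commute[of a x] by simp
    with * show "(\<lambda>x y. x \<in> D \<and> y \<in> D \<and> NG (y - x) < e)\<^sup>*\<^sup>* x y"
      by (intro r_into_rtranclp) simp
  qed
qed (use assms D_subset in \<open>auto intro: rtranclp_trans\<close>)

text \<open>Fix a chain of \<open>d\<close>-small steps from 0 to \<open>g\<close>. For all late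
  \<open>n\<close>, each step changes \<open>\<Lambda> [(n, _)]\<close> by an element of
  \<open>B\<close>, so the values lie in a sum of finitely many compact sets.\<close>

lemma \<Lambda>_precompact:
  assumes "g \<in> D"
  shows "\<exists>K. compact K \<and> (\<forall>\<^sub>F n in sequentially. \<Lambda> [(n, g)] \<in> K)"
proof -
  obtain s B where s: "s > 0" "compact B" "{x. NH x \<le> s} \<subseteq> B"
    using H.compact_ball by blast
  obtain d M where d: "d > 0" and M:
    "\<And>n a b. n \<ge> M \<Longrightarrow> a \<in> D \<Longrightarrow> b \<in> D \<Longrightarrow> NG (a - b) < d \<Longrightarrow> NH (\<Lambda> [(n, a)] - \<Lambda> [(n, b)]) \<le> s"
    using equicontinuous_\<Lambda>[OF s(1)] by blast
  have "(\<lambda>x y. x \<in> D \<and> y \<in> D \<and> NG (y - x) < d)\<^sup>*\<^sup>* 0 g"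
    using assms d by (intro chain_in_D) auto
  then show ?thesis
  proof (induction rule: rtranclp_induct)
    case base
    show ?case
      by (intro exI[of _ "{0}"]) simp
  next
    case (step x y)
    then obtain K where K: "compact K" "\<forall>\<^sub>F n in sequentially. \<Lambda> [(n, x)] \<in> K"
      by blast
    let ?K' = "(\<lambda>(u, v). u + v) ` (B \<times> K)"
    have "compact ?K'"
      by (intro compact_continuous_image compact_Times s K)
         (auto simp: case_prod_unfold intro!: continuous_intros)
    moreover have "\<forall>\<^sub>F n in sequentially. \<Lambda> [(n, y)] \<in> ?K'"
      using K(2) eventually_ge_at_top[of M]
    proof eventually_elim
      case (elim n)
      have "\<Lambda> [(n, y)] - \<Lambda> [(n, x)] \<in> B"
        using M[OF elim(2), of y x] step s(3) by blast
      then show ?case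
        using elim by (intro image_eqI[of _ _ "(\<Lambda> [(n, y)] - \<Lambda> [(n, x)], \<Lambda> [(n, x)])"]) auto
    qed
    ultimately show ?case
      by blast
  qed
qed

text \<open>Diagonal extraction over an enumeration of \<open>D\<close>, carried out as sequential
  compactness of a countable product of compact sets.\<close>

lemma \<Lambda>_subseq_limit:
  obtains r S where "strict_mono r" "\<And>g. g \<in> D \<Longrightarrow> (\<lambda>n. \<Lambda> [(r n, g)]) \<longlonglongrightarrow> S g"
proof -
  define en where "en = from_nat_into D"
  have "D \<noteq> {}"
    using zero_in_D by blast
  then have en: "range en = D"
    unfolding en_def using countable_D by (intro range_from_nat_into)
  have "\<exists>K. compact K \<and> (\<forall>n. \<Lambda> [(n, en i)] \<in> K)" for i
  proof -
    obtain K n0 where K: "compact K" "\<And>n. n \<ge> n0 \<Longrightarrow> \<Lambda> [(n, en i)] \<in> K"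
      using \<Lambda>_precompact[of "en i"] en unfolding eventually_sequentially by blast
    \<comment> \<open>The finitely many early values are added because the product has to contain
      \<open>F n\<close> for every \<open>n\<close>.\<close>
    have "compact (K \<union> (\<lambda>n. \<Lambda> [(n, en i)]) ` {..<n0})"
      by (intro compact_Un K(1) finite_imp_compact finite_imageI) simp
    moreover have "\<Lambda> [(n, en i)] \<in> K \<union> (\<lambda>n. \<Lambda> [(n, en i)]) ` {..<n0}" for n
      using K(2)[of n] by (cases "n < n0") auto
    ultimately show ?thesis
      by blast
  qed
  then obtain K where K: "\<And>i. compact (K i)" "\<And>i n. \<Lambda> [(n, en i)] \<in> K i"
    by metis
  define F where "F n i = \<Lambda> [(n, en i)]" for n i
  have "compactin (product_topology (\<lambda>i::nat. euclidean) UNIV) (PiE UNIV K)"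
    using K by (simp add: compactin_PiE)
  then have "seq_compact (PiE UNIV K)"
    by (intro compact_imp_seq_compact) (simp add: euclidean_product_topology)
  moreover have "\<forall>n. F n \<in> PiE UNIV K"
    using K(2) by (auto simp: F_def)
  ultimately obtain l r where r: "strict_mono r" "(F \<circ> r) \<longlonglongrightarrow> l"
    by (rule seq_compactE)
  have "(\<lambda>n. \<Lambda> [(r n, en i)]) \<longlonglongrightarrow> l i" for i
    using continuous_on_tendsto_compose[OF continuous_on_product_coordinates[of i] r(2)]
    by (simp add: F_def o_def)
  then have "\<forall>g\<in>range en. \<exists>s. (\<lambda>n. \<Lambda> [(r n, g)]) \<longlonglongrightarrow> s"
    by blast
  then have "\<exists>s. (\<lambda>n. \<Lambda> [(r n, g)]) \<longlonglongrightarrow> s" if "g \<in> D" for g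
    using that unfolding en by blast
  then show ?thesis
    using that[OF r(1)] by metis
qed

end

section \<open>Additivity of the limit map\<close>

locale limit_reduction = dense_generic_reduction +
  fixes r :: "nat \<Rightarrow> nat" and S :: "'a \<Rightarrow> 'b"
  assumes mono_r: "strict_mono r"
    and S_lim: "g \<in> D \<Longrightarrow> (\<lambda>n. \<Lambda> [(r n, g)]) \<longlonglongrightarrow> S g"
begin

lemma S_zero [simp]: "S 0 = 0"
  using S_lim[of 0] by (simp add: LIMSEQ_const_iff)

lemma S_unif:
  assumes "e > 0"
  obtains d where "d > 0" "\<And>a b. a \<in> D \<Longrightarrow> b \<in> D \<Longrightarrow> NG (a - b) < d \<Longrightarrow> NH (S a - S b) \<le> e"
proof -
  obtain d M where d: "d > 0" and M:
    "\<And>n a b. n \<ge> M \<Longrightarrow> a \<in> D \<Longrightarrow> b \<in> D \<Longrightarrow> NG (a - b) < d \<Longrightarrow> NH (\<Lambda> [(n, a)] - \<Lambda> [(n, b)]) \<le> e"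
    using equicontinuous_\<Lambda>[OF assms] by blast
  show ?thesis
  proof (rule that[OF d])
    fix a b assume *: "a \<in> D" "b \<in> D" "NG (a - b) < d"
    show "NH (S a - S b) \<le> e"
    proof (rule LIMSEQ_le_const2)
      show "(\<lambda>n. NH (\<Lambda> [(r n, a)] - \<Lambda> [(r n, b)])) \<longlonglongrightarrow> NH (S a - S b)"
        by (rule continuous_on_tendsto_compose[OF H.continuous_on_N[of UNIV]])
           (auto intro!: tendsto_intros S_lim *)
      have "r n \<ge> M" if "n \<ge> M" for n
        using seq_suble[OF mono_r, of n] that by simp
      then show "\<exists>N. \<forall>n\<ge>N. NH (\<Lambda> [(r n, a)] - \<Lambda> [(r n, b)]) \<le> e"
        using M * by blast
    qed
  qed
qed

text \<open>\<open>Q k\<close> fixes the pair and asks only for a time at which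
  \<open>\<Lambda>\<close> is within \<open>(1/2) ^ k\<close> of \<open>S\<close> on both entries;
  such times occur arbitrarily late along \<open>r\<close>. The errors are summable, so
  \<open>S\<close> may replace \<open>\<Lambda>\<close>.\<close>

lemma fusion_S:
  assumes a: "\<And>k. a k \<in> D" and b: "\<And>k. b k \<in> D"
  obtains n where "strict_mono n"
    "summable (\<lambda>k. a k - b k) \<longleftrightarrow> summable (\<lambda>k. S (a k) - S (b k)) \<and>
       (\<forall>e>0. \<exists>K. \<forall>k\<ge>K. \<forall>p. NH (\<Delta> [(n k, a k)] p - \<Delta> [(n k, b k)] p) \<le> e)"
proof -
  define Q where "Q k = {(n, a', b'). a' = a k \<and> b' = b k \<and> NH (\<Lambda> [(n, a k)] - S (a k)) \<le> (1/2) ^ k \<and>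
    NH (\<Lambda> [(n, b k)] - S (b k)) \<le> (1/2) ^ k}" for k
  have Q: "\<exists>n a' b'. (n, a', b') \<in> Q k \<and> M \<le> n \<and> a' \<in> D \<and> b' \<in> D" for k M
  proof -
    have ev: "\<forall>\<^sub>F j in sequentially. NH (\<Lambda> [(r j, g)] - S g) \<le> (1/2) ^ k" if "g \<in> D" for g
    proof -
      have "((\<lambda>j. NH (\<Lambda> [(r j, g)] - S g)) \<longlongrightarrow> 0) sequentially"
        using S_lim[OF that] by (subst (asm) H.tendsto_iff_N)
      then have "\<forall>\<^sub>F j in sequentially. NH (\<Lambda> [(r j, g)] - S g) < (1/2) ^ k"
        by (rule order_tendstoD) simp
      then show ?thesis
        by eventually_elim simp
    qed
    have "\<forall>\<^sub>F j in sequentially. (r j, a k, b k) \<in> Q k \<and> M \<le> r j"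
      using ev[OF a[of k]] ev[OF b[of k]] eventually_ge_at_top[of M]
    proof eventually_elim
      case (elim j)
      then show ?case
        using seq_suble[OF mono_r, of j] by (simp add: Q_def)
    qed
    then obtain j where "(r j, a k, b k) \<in> Q k \<and> M \<le> r j"
      using eventually_happens'[OF sequentially_bot] by blast
    then show ?thesis
      using a b by blast
  qed
  obtain n a' b' where n: "strict_mono n" and nQ: "\<And>k. (n k, a' k, b' k) \<in> Q k"
    and fus: "summable (\<lambda>k. a' k - b' k) \<longleftrightarrow>
       summable (\<lambda>k. \<Lambda> [(n k, a' k)] - \<Lambda> [(n k, b' k)]) \<and>
       (\<forall>e>0. \<exists>K. \<forall>k\<ge>K. \<forall>p. NH (\<Delta> [(n k, a' k)] p - \<Delta> [(n k, b' k)] p) \<le> e)"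
    by (rule fusion[of Q, OF Q]) (rule that; assumption)
  have "a' = a" "b' = b"
    using nQ by (auto simp: Q_def fun_eq_iff)
  define d where "d k = (\<Lambda> [(n k, a k)] - S (a k)) - (\<Lambda> [(n k, b k)] - S (b k))" for k
  have d: "NH (d k) \<le> 2 * (1/2) ^ k" for k
    unfolding d_def using nQ[of k] by (intro order_trans[OF H.diff_le]) (simp add: Q_def)
  have geo: "summable (\<lambda>k. 2 * (1/2) ^ k :: real)"
    by (intro summable_mult summable_geometric) simp
  have "summable d" "summable (\<lambda>k. - d k)"
    using d by (auto intro!: H.summable_comparison_N[OF geo])
  moreover have "(\<lambda>k. (S (a k) - S (b k)) + d k) = (\<lambda>k. \<Lambda> [(n k, a k)] - \<Lambda> [(n k, b k)])"
    "(\<lambda>k. (\<Lambda> [(n k, a k)] - \<Lambda> [(n k, b k)]) + - d k) = (\<lambda>k. S (a k) - S (b k))"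
    by (simp_all add: d_def fun_eq_iff)
  ultimately have "summable (\<lambda>k. \<Lambda> [(n k, a k)] - \<Lambda> [(n k, b k)]) \<longleftrightarrow> summable (\<lambda>k. S (a k) - S (b k))"
    using summable_add[of "\<lambda>k. S (a k) - S (b k)" d]
      summable_add[of "\<lambda>k. \<Lambda> [(n k, a k)] - \<Lambda> [(n k, b k)]" "\<lambda>k. - d k"] by auto
  then show ?thesis
    using that[OF n] fus \<open>a' = a\<close> \<open>b' = b\<close> by simp
qed

lemma summable_S:
  assumes "\<And>k. a k \<in> D" "\<And>k. b k \<in> D" "summable (\<lambda>k. a k - b k)"
  shows "summable (\<lambda>k. S (a k) - S (b k))"
  by (rule fusion_S[of a b, OF assms(1,2)]) (use assms(3) in blast)

text \<open>Pulling convergence back requires vanishing transients. As \<open>a\<close> tends to 0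
  and a jump by 0 has no effect, equicontinuity provides this.\<close>

lemma summable_if_summable_S:
  assumes a: "\<And>k. a k \<in> D" "a \<longlonglongrightarrow> 0" and S: "summable (\<lambda>k. S (a k))"
  shows "summable a"
proof -
  obtain n where n: "strict_mono n" and fus:
    "summable (\<lambda>k. a k - 0) \<longleftrightarrow> summable (\<lambda>k. S (a k) - S 0) \<and>
       (\<forall>e>0. \<exists>K. \<forall>k\<ge>K. \<forall>p. NH (\<Delta> [(n k, a k)] p - \<Delta> [(n k, 0)] p) \<le> e)"
    by (rule fusion_S[of a "\<lambda>_. 0", OF a(1) zero_in_D]) (rule that; assumption)
  have "\<exists>K. \<forall>k\<ge>K. \<forall>p. NH (\<Delta> [(n k, a k)] p - \<Delta> [(n k, 0)] p) \<le> e" if e: "e > 0" for e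
  proof -
    obtain d M where d: "d > 0" and M:
      "\<And>n a b p. n \<ge> M \<Longrightarrow> a \<in> D \<Longrightarrow> b \<in> D \<Longrightarrow> NG (a - b) < d \<Longrightarrow> NH (\<Delta> [(n, a)] p - \<Delta> [(n, b)] p) \<le> e"
      using equicontinuous_\<Delta>[OF e] by blast
    obtain K where K: "\<And>k. k \<ge> K \<Longrightarrow> NG (a k - 0) < d"
      using a(2) d unfolding G.LIMSEQ_iff_N by blast
    show ?thesis
    proof (intro exI[of _ "max K M"] allI impI)
      fix k p assume "k \<ge> max K M"
      then show "NH (\<Delta> [(n k, a k)] p - \<Delta> [(n k, 0)] p) \<le> e"
        using seq_suble[OF n, of k] K[of k] a(1) by (intro M) auto
    qed
  qed
  then show ?thesis
    using fus S by simp
qed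

text \<open>Moving along a walk \<open>u\<close> with vanishing steps that oscillates between 0 and \<open>g\<close>, the partial sums of the
  jumps cancel, while those of their images under \<open>S\<close> are the values of \<open>S (h + u) - S u\<close>. Hence this
  function takes the same value at 0 and at \<open>g\<close>.\<close>

lemma S_add:
  assumes g: "g \<in> D" and h: "h \<in> D"
  shows "S (h + g) = S h + S g"
proof -
  define c where "c k = (if even k then 0 else g)" for k :: nat
  have c: "c k \<in> D" for k
    using g by (simp add: c_def)
  obtain u K where K: "strict_mono K" "K 0 = 0" and uK: "\<And>k. u (K k) = c k"
    and u: "\<And>k j. K k \<le> j \<Longrightarrow> \<exists>i\<ge>k. u j \<in> D \<and> u (Suc j) \<in> D \<and> NG (u (Suc j) - u j) < (1/2) ^ i"
  proof (rule walk_through[of "\<lambda>k x y. x \<in> D \<and> y \<in> D \<and> NG (y - x) < (1/2) ^ k" c])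
    show "(\<lambda>x y. x \<in> D \<and> y \<in> D \<and> NG (y - x) < (1/2) ^ k)\<^sup>*\<^sup>* (c k) (c (Suc k))" for k
      using c by (intro chain_in_D) auto
  qed (use c in auto)
  have uD: "u j \<in> D" for j
    using u[of 0 j] K(2) by auto
  have step: "(\<lambda>j. u (Suc j) - u j) \<longlonglongrightarrow> 0"
    unfolding G.LIMSEQ_iff_N
  proof (intro allI impI)
    fix e :: real assume "e > 0"
    then obtain k where k: "(1/2) ^ k < e"
      using real_arch_pow_inv[of e "1/2"] by auto
    show "\<exists>M. \<forall>j\<ge>M. NG (u (Suc j) - u j - 0) < e"
    proof (intro exI[of _ "K k"] allI impI)
      fix j assume "j \<ge> K k"
      then obtain i where i: "i \<ge> k" "NG (u (Suc j) - u j) < (1/2) ^ i"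
        using u[of k j] by blast
      have "(1/2) ^ i \<le> (1/2 :: real) ^ k"
        using i(1) by (intro power_decreasing) auto
      then have "NG (u (Suc j) - u j) < e"
        using i(2) k by linarith
      then show "NG (u (Suc j) - u j - 0) < e"
        by simp
    qed
  qed
  \<comment> \<open>Even indices move \<open>h + u\<close> one step forward, odd indices move
    \<open>u\<close> by the same step backward.\<close>
  define a where "a k = (if even k then h + u (Suc (k div 2)) else u (k div 2))" for k
  define b where "b k = (if even k then h + u (k div 2) else u (Suc (k div 2)))" for k
  have ab: "a k \<in> D" "b k \<in> D" for k
    using uD h by (auto simp: a_def b_def intro: add_in_D)
  define \<phi> where "\<phi> x = S (h + x) - S x" for x
  have sum_ab: "(\<Sum>k<2 * j. a k - b k) = 0" for j
    by (induction j) (simp_all add: a_def b_def)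
  have sum_S: "(\<Sum>k<2 * j. S (a k) - S (b k)) = \<phi> (u j) - \<phi> (u 0)" for j
    by (induction j) (simp_all add: a_def b_def \<phi>_def algebra_simps)
  have "(\<lambda>i. \<Sum>k<i. a k - b k) \<longlonglongrightarrow> 0"
  proof -
    \<comment> \<open>After an odd number of terms one uncancelled step of \<open>u\<close> remains,
      and it tends to 0.\<close>
    have eq: "(\<Sum>k<i. a k - b k) = (if even i then 0 else u (Suc (i div 2)) - u (i div 2))" for i
    proof (cases "even i")
      case True
      then show ?thesis
        using sum_ab by (auto elim!: evenE)
    next
      case False
      then obtain j where j: "i = Suc (2 * j)"
        by (auto elim!: oddE)
      show ?thesis
        using sum_ab[of j] by (simp add: j a_def b_def)
    qed
    show ?thesis
      unfolding G.LIMSEQ_iff_N eq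
    proof (intro allI impI)
      fix e :: real assume "e > 0"
      then obtain M where "\<And>j. j \<ge> M \<Longrightarrow> NG (u (Suc j) - u j - 0) < e"
        using step unfolding G.LIMSEQ_iff_N by blast
      then show "\<exists>M. \<forall>i\<ge>M. NG ((if even i then 0 else u (Suc (i div 2)) - u (i div 2)) - 0) < e"
        using \<open>e > 0\<close> by (intro exI[of _ "2 * M"]) auto
    qed
  qed
  then have "summable (\<lambda>k. a k - b k)"
    by (auto simp: summable_def sums_def)
  from summable_S[of a b, OF ab this] obtain l where "(\<lambda>i. \<Sum>k<i. S (a k) - S (b k)) \<longlonglongrightarrow> l"
    by (auto simp: summable_def sums_def)
  then have "(\<lambda>j. \<Sum>k<2 * j. S (a k) - S (b k)) \<longlonglongrightarrow> l"
    by (rule filterlim_compose) (auto intro!: filterlim_subseq strict_monoI)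
  then have "(\<lambda>j. \<phi> (u j)) \<longlonglongrightarrow> l + \<phi> (u 0)"
    unfolding sum_S using tendsto_add[OF _ tendsto_const[of "\<phi> (u 0)"]] by fastforce
  then have lim: "(\<lambda>k. \<phi> (u (f k))) \<longlonglongrightarrow> l + \<phi> (u 0)" if "strict_mono f" for f
    using LIMSEQ_subseq_LIMSEQ[OF _ that] by (simp add: o_def)
  have "strict_mono (\<lambda>k. K (f k))" if "strict_mono f" for f
    using K(1) that by (simp add: strict_mono_def)
  note lim' = lim[OF this, unfolded uK]
  have "(\<lambda>k. \<phi> (c (2 * k))) \<longlonglongrightarrow> l + \<phi> (u 0)" "(\<lambda>k. \<phi> (c (Suc (2 * k)))) \<longlonglongrightarrow> l + \<phi> (u 0)"
    by (intro lim' strict_monoI; simp)+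
  then have "\<phi> 0 = \<phi> g"
    by (simp add: c_def LIMSEQ_const_iff)
  then show ?thesis
    by (simp add: \<phi>_def algebra_simps)
qed

end

section \<open>The kernel and the extension to the identity component\<close>

context limit_reduction
begin

lemma S_diff: "x \<in> D \<Longrightarrow> y \<in> D \<Longrightarrow> S (x - y) = S x - S y"
  using S_add[of y "x - y"] by (simp add: diff_in_D)

text \<open>\<open>D\<close> may meet the kernel only in 0, so walks in the kernel are represented
  by walks in \<open>D\<close> along which \<open>S\<close> is small. If such walks of every
  fineness reached norm \<open>\<rho>\<close>, going out and back forever would give
  \<open>u\<close> with steps and values \<open>S (u j)\<close> tending to 0. The images of the
  steps would be summable, hence the steps too, and \<open>u\<close> would converge while visiting
  both 0 and points of norm at least \<open>\<rho>\<close>.\<close>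

lemma S_small_kernel_walks:
  assumes "\<rho> > 0"
  shows "\<exists>\<delta>>0. \<forall>e. (\<lambda>x y. x \<in> D \<and> y \<in> D \<and> NH (S x) < \<delta> \<and> NH (S y) < \<delta> \<and> NG (y - x) < \<delta>)\<^sup>*\<^sup>* 0 e
    \<longrightarrow> NG e < \<rho>"
proof (rule ccontr)
  define R where "R d x y \<longleftrightarrow> x \<in> D \<and> y \<in> D \<and> NH (S x) < d \<and> NH (S y) < d \<and> NG (y - x) < d" for d x y
  have R_eq: "R d = (\<lambda>x y. x \<in> D \<and> y \<in> D \<and> NH (S x) < d \<and> NH (S y) < d \<and> NG (y - x) < d)" for d
    by (simp add: R_def fun_eq_iff)
  assume "\<not> ?thesis"
  then have neg: "\<not> (\<exists>\<delta>>0. \<forall>e. (R \<delta>)\<^sup>*\<^sup>* 0 e \<longrightarrow> NG e < \<rho>)"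
    unfolding R_eq .
  have "\<exists>e. (R ((1/2) ^ k))\<^sup>*\<^sup>* 0 e \<and> \<rho> \<le> NG e" for k
  proof -
    have "(0::real) < (1/2) ^ k"
      by simp
    then show ?thesis
      using neg not_less by blast
  qed
  then obtain e where e: "\<And>k. (R ((1/2) ^ k))\<^sup>*\<^sup>* 0 (e k)" "\<And>k. \<rho> \<le> NG (e k)"
    by metis
  \<comment> \<open>From an even \<open>k\<close> the walk goes out to \<open>e (Suc k)\<close>,
    which is possible at the finer scale \<open>(1/2) ^ Suc k\<close>; from an odd \<open>k\<close>
    the walk to \<open>e k\<close> is retraced. Hence \<open>mono\<close> and \<open>sym\<close>
    below.\<close>
  define c where "c k = (if even k then 0 else e k)" for k :: nat
  have reach: "x \<in> D \<and> NH (S x) < d" if "(R d)\<^sup>*\<^sup>* 0 x" "d > 0" for x d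
    using that by (induction rule: rtranclp_induct) (auto simp: R_def)
  have sym: "(R d)\<^sup>*\<^sup>* y x" if "(R d)\<^sup>*\<^sup>* x y" for x y d
    using that
  proof (induction rule: rtranclp_induct)
    case (step y w)
    then have "R d w y"
      by (auto simp: R_def G.minus_commute)
    then show ?case
      using step.IH by (rule converse_rtranclp_into_rtranclp)
  qed simp
  have mono: "(R d')\<^sup>*\<^sup>* x y" if "(R d)\<^sup>*\<^sup>* x y" "d \<le> d'" for x y d d'
  proof -
    have "R d \<le> R d'"
      using that(2) by (auto simp: R_def)
    then show ?thesis
      using rtranclp_mono that(1) by blast
  qed
  obtain u K where K: "strict_mono K" "K 0 = 0" and uK: "\<And>k. u (K k) = c k"
    and u: "\<And>k j. K k \<le> j \<Longrightarrow> \<exists>i\<ge>k. R ((1/2) ^ i) (u j) (u (Suc j))"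
  proof (rule walk_through[of "\<lambda>k. R ((1/2) ^ k)" c])
    fix k :: nat
    show "(R ((1/2) ^ k))\<^sup>*\<^sup>* (c k) (c (Suc k))"
    proof (cases "even k")
      case True
      then show ?thesis
        using mono[OF e(1)[of "Suc k"], of "(1/2) ^ k"] by (simp add: c_def)
    next
      case False
      then show ?thesis
        using sym[OF e(1)[of k]] by (simp add: c_def)
    qed
    have "(R ((1/2) ^ k))\<^sup>*\<^sup>* 0 (c k)"
      using e(1) by (simp add: c_def)
    from reach[OF this] show "R ((1/2) ^ k) (c k) (c k)"
      by (simp add: R_def)
  qed (rule that; assumption)
  have pow: "(1/2) ^ i \<le> (1/2 :: real) ^ k" if "k \<le> i" for i k :: nat
    using that by (intro power_decreasing) auto
  have uD: "u j \<in> D" for j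
    using u[of 0 j] K(2) by (auto simp: R_def)
  have small: "\<exists>M. \<forall>j\<ge>M. NH (S (u j)) < d \<and> NG (u (Suc j) - u j) < d" if d: "d > 0" for d
  proof -
    obtain k where k: "(1/2) ^ k < d"
      using real_arch_pow_inv[OF d, of "1/2"] by auto
    have "NH (S (u j)) < d \<and> NG (u (Suc j) - u j) < d" if "j \<ge> K k" for j
    proof -
      obtain i where i: "i \<ge> k" "R ((1/2) ^ i) (u j) (u (Suc j))"
        using u[OF \<open>j \<ge> K k\<close>] by blast
      have "(1/2) ^ i < d"
        using pow[OF i(1)] k by linarith
      then show ?thesis
        using i(2) by (auto simp: R_def)
    qed
    then show ?thesis
      by blast
  qed
  define a where "a j = u (Suc j) - u j" for j
  have "a \<longlonglongrightarrow> 0"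
    unfolding G.LIMSEQ_iff_N a_def using small by (metis diff_zero)
  moreover have "summable (\<lambda>j. S (a j))"
  proof -
    have "S (a j) = S (u (Suc j)) - S (u j)" for j
      using uD by (simp add: a_def S_diff)
    then have "(\<Sum>j<i. S (a j)) = S (u i) - S (u 0)" for i
      by (induction i) simp_all
    moreover have "(\<lambda>i. S (u i)) \<longlonglongrightarrow> 0"
      unfolding H.LIMSEQ_iff_N using small by (metis diff_zero)
    then have "(\<lambda>i. S (u i) - S (u 0)) \<longlonglongrightarrow> 0 - S (u 0)"
      by (intro tendsto_intros)
    ultimately show ?thesis
      unfolding summable_def sums_def by auto
  qed
  ultimately have "summable a"
    using uD by (intro summable_if_summable_S) (auto simp: a_def diff_in_D)
  then obtain l where "(\<lambda>i. \<Sum>j<i. a j) \<longlonglongrightarrow> l"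
    by (auto simp: summable_def sums_def)
  moreover have "(\<Sum>j<i. a j) = u i" for i
    using uK[of 0] K(2) by (induction i) (simp_all add: a_def c_def)
  ultimately have "u \<longlonglongrightarrow> l"
    by simp
  then have lim: "(\<lambda>k. u (f k)) \<longlonglongrightarrow> l" if "strict_mono f" for f
    using LIMSEQ_subseq_LIMSEQ[OF _ that] by (simp add: o_def)
  have "strict_mono (\<lambda>k. K (f k))" if "strict_mono f" for f
    using K(1) that by (simp add: strict_mono_def)
  note lim' = lim[OF this, unfolded uK]
  have "(\<lambda>k. c (2 * k)) \<longlonglongrightarrow> l" "(\<lambda>k. c (Suc (2 * k))) \<longlonglongrightarrow> l"
    by (intro lim' strict_monoI; simp)+
  then have "(\<lambda>k. e (Suc (2 * k))) \<longlonglongrightarrow> 0"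
    by (simp add: c_def LIMSEQ_const_iff)
  then obtain k where "NG (e (Suc (2 * k)) - 0) < \<rho>"
    unfolding G.LIMSEQ_iff_N using assms by blast
  then show False
    using e(2)[of "Suc (2 * k)"] by simp
qed

text \<open>Two sequences in \<open>D\<close> with the same limit differ by a null sequence, which
  \<open>S\<close> maps to a null sequence. Quantifying over all approximating sequences makes the
  value independent of the choice; at points that \<open>D\<close> does not approach it is
  arbitrary.\<close>

lemma S_extension:
  "\<exists>S'. \<forall>x d. (\<forall>n. d n \<in> D) \<longrightarrow> d \<longlonglongrightarrow> x \<longrightarrow> (\<lambda>n. S (d n)) \<longlonglongrightarrow> S' x"
proof -
  have null: "(\<lambda>n. S (d n)) \<longlonglongrightarrow> 0" if d: "\<And>n. d n \<in> D" "d \<longlonglongrightarrow> 0" for d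
    unfolding H.LIMSEQ_iff_N
  proof (intro allI impI)
    fix e :: real assume "e > 0"
    then obtain \<delta> where \<delta>: "\<delta> > 0" "\<And>a b. a \<in> D \<Longrightarrow> b \<in> D \<Longrightarrow> NG (a - b) < \<delta> \<Longrightarrow> NH (S a - S b) \<le> e / 2"
      using S_unif[of "e / 2"] by (metis half_gt_zero)
    obtain M where "\<And>n. n \<ge> M \<Longrightarrow> NG (d n - 0) < \<delta>"
      using d(2) \<delta>(1) unfolding G.LIMSEQ_iff_N by blast
    then have "NH (S (d n) - 0) < e" if "n \<ge> M" for n
      using \<delta>(2)[OF d(1)[of n] zero_in_D] that \<open>e > 0\<close> by fastforce
    then show "\<exists>M. \<forall>n\<ge>M. NH (S (d n) - 0) < e"
      by blast
  qed
  have "\<exists>l. \<forall>d. (\<forall>n. d n \<in> D) \<longrightarrow> d \<longlonglongrightarrow> x \<longrightarrow> (\<lambda>n. S (d n)) \<longlonglongrightarrow> l" for x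
  proof (cases "\<exists>d. (\<forall>n. d n \<in> D) \<and> d \<longlonglongrightarrow> x")
    case True
    then obtain d where d: "\<And>n. d n \<in> D" "d \<longlonglongrightarrow> x"
      by blast
    have "convergent (\<lambda>n. S (d n))"
    proof (rule H.N_Cauchy_convergent)
      fix e :: real assume "e > 0"
      then obtain \<delta> where \<delta>: "\<delta> > 0" "\<And>a b. a \<in> D \<Longrightarrow> b \<in> D \<Longrightarrow> NG (a - b) < \<delta> \<Longrightarrow> NH (S a - S b) \<le> e"
        using S_unif[of e] by blast
      obtain M where M: "\<And>p q. p \<ge> M \<Longrightarrow> q \<ge> M \<Longrightarrow> NG (d p - d q) \<le> \<delta> / 2"
        by (rule G.convergent_imp_N_Cauchy[of d "\<delta> / 2"])
           (use d(2) \<delta>(1) in \<open>auto simp: convergent_def\<close>)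
      have "NH (S (d p) - S (d q)) \<le> e" if "p \<ge> M" "q \<ge> M" for p q
        using M[OF that] \<delta>(1) d(1) by (intro \<delta>(2)) auto
      then show "\<exists>M. \<forall>p\<ge>M. \<forall>q\<ge>M. NH (S (d p) - S (d q)) \<le> e"
        by blast
    qed
    then obtain l where l: "(\<lambda>n. S (d n)) \<longlonglongrightarrow> l"
      by (auto simp: convergent_def)
    have "(\<lambda>n. S (d' n)) \<longlonglongrightarrow> l" if d': "\<And>n. d' n \<in> D" "d' \<longlonglongrightarrow> x" for d'
    proof -
      have "(\<lambda>n. d' n - d n) \<longlonglongrightarrow> x - x"
        by (intro tendsto_diff d d')
      then have "(\<lambda>n. S (d' n - d n)) \<longlonglongrightarrow> 0"
        using d(1) d'(1) by (intro null) (auto simp: diff_in_D)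
      then have "(\<lambda>n. S (d' n - d n) + S (d n)) \<longlonglongrightarrow> 0 + l"
        by (intro tendsto_add l)
      then show ?thesis
        using d(1) d'(1) by (simp add: S_diff)
    qed
    then show ?thesis
      by blast
  qed blast
  then show ?thesis
    by (intro choice) simp
qed

text \<open>For the kernel, the points reached from 0 by small steps inside it form an open
  subgroup. Walks in \<open>D\<close> shadow these steps, so \<open>S_small_kernel_walks\<close>
  keeps the subgroup within the given neighbourhood.\<close>

theorem limit_homomorphism:
  assumes G0: "is_subgroup (identity_component :: 'a set)"
  shows "\<exists>S' :: 'a \<Rightarrow> 'b. hom_on identity_component identity_component S' \<and>
    continuous_on identity_component S' \<and> non_archimedean (ker_on identity_component S')"
proof -
  let ?G = "identity_component :: 'a set"
  obtain S' where "\<forall>x d. (\<forall>n. d n \<in> D) \<longrightarrow> d \<longlonglongrightarrow> x \<longrightarrow> (\<lambda>n. S (d n)) \<longlonglongrightarrow> S' x"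
    using S_extension by blast
  then have S': "\<And>x d. (\<And>n. d n \<in> D) \<Longrightarrow> d \<longlonglongrightarrow> x \<Longrightarrow> (\<lambda>n. S (d n)) \<longlonglongrightarrow> S' x"
    by blast
  have S'_D: "S' x = S x" if "x \<in> D" for x
    using S'[of "\<lambda>_. x" x] that by (simp add: LIMSEQ_const_iff)
  have approx: "\<exists>d. (\<forall>n. d n \<in> D) \<and> d \<longlonglongrightarrow> x" if "x \<in> ?G" for x
    using that D_dense closure_sequential by blast
  have add: "S' (x + y) = S' x + S' y" if xy: "x \<in> ?G" "y \<in> ?G" for x y
  proof -
    obtain c d where c: "\<And>n. c n \<in> D" "c \<longlonglongrightarrow> x" and d: "\<And>n. d n \<in> D" "d \<longlonglongrightarrow> y"
      using approx xy by metis
    have "(\<lambda>n. S (c n + d n)) \<longlonglongrightarrow> S' (x + y)"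
      using c d by (intro S' tendsto_add add_in_D)
    moreover have "(\<lambda>n. S (c n) + S (d n)) \<longlonglongrightarrow> S' x + S' y"
      using c d by (intro tendsto_add S')
    ultimately show ?thesis
      using c d by (simp add: S_add LIMSEQ_unique)
  qed
  have unif: "\<exists>\<delta>>0. \<forall>x\<in>?G. \<forall>y\<in>?G. NG (x - y) < \<delta> \<longrightarrow> NH (S' x - S' y) \<le> e" if e: "e > 0" for e
  proof -
    obtain \<delta> where \<delta>: "\<delta> > 0" "\<And>a b. a \<in> D \<Longrightarrow> b \<in> D \<Longrightarrow> NG (a - b) < \<delta> \<Longrightarrow> NH (S a - S b) \<le> e"
      using S_unif[OF e] by blast
    have "NH (S' x - S' y) \<le> e" if xy: "x \<in> ?G" "y \<in> ?G" "NG (x - y) < \<delta>" for x y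
    proof -
      obtain c d where c: "\<And>n. c n \<in> D" "c \<longlonglongrightarrow> x" and d: "\<And>n. d n \<in> D" "d \<longlonglongrightarrow> y"
        using approx xy by metis
      have "(\<lambda>n. NG (c n - d n)) \<longlonglongrightarrow> NG (x - y)"
        by (rule continuous_on_tendsto_compose[OF G.continuous_on_N[of UNIV]])
           (auto intro!: tendsto_intros c d)
      then have "\<forall>\<^sub>F n in sequentially. NG (c n - d n) < \<delta>"
        using xy(3) by (rule order_tendstoD)
      then have ev: "\<forall>\<^sub>F n in sequentially. NH (S (c n) - S (d n)) \<le> e"
        by eventually_elim (use \<delta>(2) c(1) d(1) in blast)
      have "(\<lambda>n. NH (S (c n) - S (d n))) \<longlonglongrightarrow> NH (S' x - S' y)"
        by (rule continuous_on_tendsto_compose[OF H.continuous_on_N[of UNIV]])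
           (auto intro!: tendsto_intros S' c d)
      then show ?thesis
        using ev by (rule tendsto_upperbound) simp
    qed
    then show ?thesis
      using \<delta>(1) by blast
  qed
  have cont: "continuous_on ?G S'"
    unfolding continuous_on_def
  proof
    fix x assume x: "x \<in> ?G"
    show "(S' \<longlongrightarrow> S' x) (at x within ?G)"
    proof (subst H.tendsto_iff_N, rule tendstoI)
      fix e :: real assume "e > 0"
      then obtain \<delta> where \<delta>: "\<delta> > 0" "\<forall>x\<in>?G. \<forall>y\<in>?G. NG (x - y) < \<delta> \<longrightarrow> NH (S' x - S' y) \<le> e / 2"
        using unif[of "e / 2"] by auto
      have "dist (NH (S' y - S' x)) 0 < e" if "NG (y - x) < \<delta>" "y \<in> ?G" for y
      proof -
        have "NH (S' y - S' x) \<le> e / 2"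
          using \<delta>(2) that x by blast
        then show ?thesis
          using H.nonneg[of "S' y - S' x"] \<open>e > 0\<close> by simp
      qed
      then show "\<forall>\<^sub>F y in at x within ?G. dist (NH (S' y - S' x)) 0 < e"
        unfolding eventually_at_topological using \<delta>(1) G.open_N_ball[of x \<delta>]
        by (intro exI[of _ "{y. NG (y - x) < \<delta>}"]) auto
    qed
  qed
  have G_zero: "0 \<in> ?G" and G_add: "x \<in> ?G \<Longrightarrow> y \<in> ?G \<Longrightarrow> x + y \<in> ?G"
    and G_minus: "x \<in> ?G \<Longrightarrow> - x \<in> ?G" for x y
    using G0 by (auto simp: is_subgroup_def)
  have S'_zero: "S' 0 = 0"
    by (simp add: S'_D)
  have S'_minus: "S' (- x) = - S' x" if "x \<in> ?G" for x
    using add[of x "- x"] that G_minus[OF that] S'_zero by (simp add: eq_neg_iff_add_eq_0 add.commute)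
  have "S' ` ?G \<subseteq> connected_component_set UNIV 0"
  proof (rule connected_component_maximal)
    show "0 \<in> S' ` ?G"
      using G_zero S'_zero by force
    show "connected (S' ` ?G)"
      by (intro connected_continuous_image cont) (simp add: identity_component_def)
  qed simp
  then have hom: "hom_on ?G identity_component S'"
    using add by (auto simp: hom_on_def identity_component_def)
  let ?K = "ker_on ?G S'"
  have K_zero: "0 \<in> ?K" and K_add: "x \<in> ?K \<Longrightarrow> y \<in> ?K \<Longrightarrow> x + y \<in> ?K" and K_minus: "x \<in> ?K \<Longrightarrow> - x \<in> ?K"
    and K_G: "x \<in> ?K \<Longrightarrow> x \<in> ?G" and K_S': "x \<in> ?K \<Longrightarrow> S' x = 0" for x y
    by (auto simp: ker_on_def G_zero S'_zero G_add add G_minus S'_minus)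
  have "non_archimedean ?K"
    unfolding non_archimedean_def
  proof (intro allI impI)
    fix U assume U: "openin (top_of_set ?K) U \<and> 0 \<in> U"
    then obtain W where W: "open W" "U = ?K \<inter> W"
      by (auto simp: openin_open)
    then obtain \<rho> where \<rho>: "\<rho> > 0" "\<And>x. NG x < \<rho> \<Longrightarrow> x \<in> W"
      using G.small_nhds[of W] U by blast
    obtain \<delta> where \<delta>: "\<delta> > 0" "\<And>e. (\<lambda>x y. x \<in> D \<and> y \<in> D \<and> NH (S x) < \<delta> \<and> NH (S y) < \<delta> \<and> NG (y - x) < \<delta>)\<^sup>*\<^sup>* 0 e
        \<Longrightarrow> NG e < \<rho> / 2"
      using S_small_kernel_walks[of "\<rho> / 2"] \<rho>(1) by auto
    define R where "R = (\<lambda>x y. x \<in> D \<and> y \<in> D \<and> NH (S x) < \<delta> \<and> NH (S y) < \<delta> \<and> NG (y - x) < \<delta>)"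
    obtain \<delta>' where \<delta>': "\<delta>' > 0" "\<forall>x\<in>?G. \<forall>y\<in>?G. NG (x - y) < \<delta>' \<longrightarrow> NH (S' x - S' y) \<le> \<delta> / 2"
      using unif[of "\<delta> / 2"] \<delta>(1) by auto
    \<comment> \<open>\<open>\<delta> / 3\<close> keeps the shadows of consecutive points less than
      \<open>\<delta>\<close> apart, \<open>\<delta>'\<close> makes \<open>S\<close> small at a
      shadow, and \<open>\<rho> / 2\<close> pays for the return from the shadow to the
      point.\<close>
    define \<sigma> where "\<sigma> = min (\<delta> / 3) (min \<delta>' (\<rho> / 2))"
    have \<sigma>: "\<sigma> > 0" "\<sigma> \<le> \<delta> / 3" "\<sigma> \<le> \<delta>'" "\<sigma> \<le> \<rho> / 2"
      using \<delta>(1) \<delta>'(1) \<rho>(1) by (auto simp: \<sigma>_def)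
    have S_small: "NH (S d) < \<delta>" if "d \<in> D" "x \<in> ?K" "NG (d - x) < \<sigma>" for d x
    proof -
      have "NH (S' d - S' x) \<le> \<delta> / 2"
        using \<delta>'(2) that \<sigma>(3) D_subset K_G by (meson less_le_trans subsetD)
      then show ?thesis
        using that S'_D K_S' \<delta>(1) by simp
    qed
    define P where "P = (\<lambda>x y. x \<in> ?K \<and> y \<in> ?K \<and> NG (y - x) < \<delta> / 3)"
    \<comment> \<open>The subgroup generated by a ball of the kernel; invariance of
      \<open>NG\<close> gives closure under sums, and appending one step gives openness.\<close>
    define V where "V = {x. P\<^sup>*\<^sup>* 0 x}"
    have V_K: "x \<in> ?K" if "P\<^sup>*\<^sup>* 0 x" for x
      using that by (induction rule: rtranclp_induct) (auto simp: P_def K_zero)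
    \<comment> \<open>The induction covers every \<open>d\<close> near the end point, so the shadow
      of the preceding point can be chosen freely.\<close>
    have shadow: "R\<^sup>*\<^sup>* 0 d" if "P\<^sup>*\<^sup>* 0 x" "d \<in> D" "NG (d - x) < \<sigma>" for x d
      using that
    proof (induction arbitrary: d rule: rtranclp_induct)
      case base
      then have "R 0 d"
        using S_small[OF _ K_zero, of d] \<sigma>(2) \<delta>(1) by (simp add: R_def)
      then show ?case
        by blast
    next
      case (step x y)
      have xy: "x \<in> ?K" "y \<in> ?K" "NG (y - x) < \<delta> / 3"
        using step.hyps by (auto simp: P_def)
      obtain d' where d': "d' \<in> D" "NG (d' - x) < \<sigma>"
        using D_approx[OF K_G[OF xy(1)] \<sigma>(1)] by blast
      have "NG (d - d') < \<delta>"
        using G.diff_triangle[of d d' y] G.diff_triangle[of y d' x] G.minus_commute[of x d'] d'(2) step.prems(2) xy(3) \<sigma>(2)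
        by simp
      then have "R d' d"
        using S_small[OF d'(1) xy(1) d'(2)] S_small[OF step.prems(1) xy(2) step.prems(2)] d'(1) step.prems(1)
        by (simp add: R_def)
      then show ?case
        using step.IH[OF d'] by (rule rtranclp.rtrancl_into_rtrancl[rotated])
    qed
    have "V \<subseteq> U"
    proof
      fix x assume "x \<in> V"
      then have x: "P\<^sup>*\<^sup>* 0 x"
        by (simp add: V_def)
      obtain d where d: "d \<in> D" "NG (d - x) < \<sigma>"
        using D_approx[OF K_G[OF V_K[OF x]] \<sigma>(1)] by blast
      have "NG d < \<rho> / 2"
        using shadow[OF x d] unfolding R_def by (rule \<delta>(2))
      then have "NG x < \<rho>"
        using G.diff_triangle[of x 0 d] G.minus_commute[of x d] d(2) \<sigma>(4) by simp
      then show "x \<in> U"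
        using \<rho>(2) V_K[OF x] W(2) by blast
    qed
    moreover have "is_subgroup V"
      unfolding is_subgroup_def
    proof (intro conjI ballI)
      show "0 \<in> V"
        by (simp add: V_def)
    next
      fix x y assume "x \<in> V" "y \<in> V"
      then have x: "P\<^sup>*\<^sup>* 0 x" and y: "P\<^sup>*\<^sup>* 0 y"
        by (simp_all add: V_def)
      from y have "P\<^sup>*\<^sup>* 0 (x + y)"
      proof (induction rule: rtranclp_induct)
        case base
        then show ?case
          using x by simp
      next
        case (step y w)
        then have "P (x + y) (x + w)"
          using V_K[OF x] K_add by (auto simp: P_def)
        then show ?case
          using step.IH by (rule rtranclp.rtrancl_into_rtrancl[rotated])
      qed
      then show "x + y \<in> V"
        by (simp add: V_def)
    next
      fix x assume "x \<in> V"
      then have "P\<^sup>*\<^sup>* 0 x"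
        by (simp add: V_def)
      then have "P\<^sup>*\<^sup>* 0 (- x)"
      proof (induction rule: rtranclp_induct)
        case (step y w)
        then have "P (- y) (- w)"
          using K_minus G.minus_commute[of y w] by (auto simp: P_def)
        then show ?case
          using step.IH by (rule rtranclp.rtrancl_into_rtrancl[rotated])
      qed simp
      then show "- x \<in> V"
        by (simp add: V_def)
    qed
    moreover have "openin (top_of_set ?K) V"
    proof (subst openin_subopen, intro ballI)
      fix x assume "x \<in> V"
      then have x: "P\<^sup>*\<^sup>* 0 x"
        by (simp add: V_def)
      have "y \<in> V" if "y \<in> ?K \<inter> {y. NG (y - x) < \<delta> / 3}" for y
      proof -
        have "P x y"
          using that V_K[OF x] by (simp add: P_def)
        then show ?thesis
          using x by (simp add: V_def)
      qed
      moreover have "openin (top_of_set ?K) (?K \<inter> {y. NG (y - x) < \<delta> / 3})"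
        by (intro openin_open_Int G.open_N_ball)
      moreover have "x \<in> ?K \<inter> {y. NG (y - x) < \<delta> / 3}"
        using V_K[OF x] \<delta>(1) by simp
      ultimately show "\<exists>T. openin (top_of_set ?K) T \<and> x \<in> T \<and> T \<subseteq> V"
        by blast
    qed
    ultimately show "\<exists>V. openin (top_of_set ?K) V \<and> is_subgroup V \<and> V \<subseteq> U"
      by blast
  qed
  with hom cont show ?thesis
    by blast
qed

end

section \<open>The identity component\<close>

lemma identity_component_subgroup:
  "is_subgroup (identity_component :: 'a::topological_group_add set)"
proof -
  let ?G = "identity_component :: 'a set"
  have zero: "0 \<in> ?G" and conn: "connected ?G"
    by (simp_all add: identity_component_def)
  have max: "A \<subseteq> ?G" if "connected A" "x \<in> A" "x \<in> ?G" for A :: "'a set" and x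
  proof -
    have "connected (A \<union> ?G)"
      using that conn by (intro connected_Un) auto
    then have "A \<union> ?G \<subseteq> ?G"
      unfolding identity_component_def
      by (intro connected_component_maximal) (use zero in \<open>auto simp: identity_component_def\<close>)
    then show ?thesis
      by blast
  qed
  have "x + y \<in> ?G" if "x \<in> ?G" "y \<in> ?G" for x y
  proof -
    have "connected ((+) x ` ?G)"
      by (intro connected_continuous_image conn continuous_intros)
    moreover have "x \<in> (+) x ` ?G"
      using zero by force
    ultimately show ?thesis
      using max that by blast
  qed
  moreover have "- x \<in> ?G" if "x \<in> ?G" for x
  proof -
    have "connected (uminus ` ?G)"
      by (intro connected_continuous_image conn continuous_intros)
    moreover have "0 \<in> uminus ` ?G"
      using zero by force
    ultimately show ?thesis
      using max zero that by blast
  qed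
  ultimately show ?thesis
    using zero by (auto simp: is_subgroup_def)
qed

text \<open>Finite sums over a countable dense set and its negatives; commutativity lets negation
  act termwise on the lists.\<close>

lemma countable_dense_subgroup:
  fixes A :: "'a::{metric_space, second_countable_topology, ab_group_add} set"
  assumes A: "is_subgroup A"
  obtains D where "countable D" "is_subgroup D" "D \<subseteq> A" "A \<subseteq> closure D"
proof -
  obtain C where C: "countable C" "C \<subseteq> A" "A \<subseteq> closure C"
    by (rule separable)
  define L where "L = lists (C \<union> uminus ` C)"
  have L: "l \<in> L \<Longrightarrow> map uminus l \<in> L" "l \<in> L \<Longrightarrow> l' \<in> L \<Longrightarrow> l @ l' \<in> L" for l l'
    by (fastforce simp: L_def)+
  have sum_minus: "- sum_list l = sum_list (map uminus l)" for l :: "'a list"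
    by (induction l) auto
  show ?thesis
  proof (rule that[of "sum_list ` L"])
    show "countable (sum_list ` L)"
      unfolding L_def using C(1) by (intro countable_image countable_lists) auto
    have "[] \<in> L"
      by (simp add: L_def)
    then have "0 \<in> sum_list ` L"
      by force
    moreover have "x + y \<in> sum_list ` L" if "x \<in> sum_list ` L" "y \<in> sum_list ` L" for x y
      using that L(2) by (auto simp flip: sum_list_append)
    moreover have "- x \<in> sum_list ` L" if "x \<in> sum_list ` L" for x
      using that L(1) by (auto simp: sum_minus)
    ultimately show "is_subgroup (sum_list ` L)"
      by (simp add: is_subgroup_def)
    have "sum_list l \<in> A" if "l \<in> L" for l
      using that[unfolded L_def] A C(2) by (induction l) (auto simp: is_subgroup_def)
    then show "sum_list ` L \<subseteq> A"
      by blast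
    have "x \<in> sum_list ` L" if "x \<in> C" for x
      using that by (intro image_eqI[of _ _ "[x]"]) (auto simp: L_def)
    then show "A \<subseteq> closure (sum_list ` L)"
      using C(3) closure_mono[of C "sum_list ` L"] by blast
  qed
qed

theorem theorem1p1:
  assumes "locally_compact_space (euclidean :: 'a::{polish_space, topological_ab_group_add} topology)"
    and "locally_compact_space (euclidean :: 'b::{polish_space, topological_ab_group_add} topology)"
    and "(E_rel :: (nat \<Rightarrow> 'a) \<Rightarrow> (nat \<Rightarrow> 'a) \<Rightarrow> bool) \<le>\<^sub>B (E_rel :: (nat \<Rightarrow> 'b) \<Rightarrow> (nat \<Rightarrow> 'b) \<Rightarrow> bool)"
  shows "\<exists>S :: 'a \<Rightarrow> 'b.
           hom_on identity_component identity_component S \<and>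
           continuous_on identity_component S \<and>
           non_archimedean (ker_on identity_component S)"
proof -
  obtain NG :: "'a \<Rightarrow> real" where NG: "group_norm NG"
    using locally_compact_group_norm[OF assms(1)] by blast
  obtain NH :: "'b \<Rightarrow> real" where NH: "group_norm NH"
    using locally_compact_group_norm[OF assms(2)] by blast
  obtain \<theta> :: "(nat \<Rightarrow> 'a) \<Rightarrow> nat \<Rightarrow> 'b" where \<theta>: "\<theta> \<in> borel_measurable borel"
    and red: "\<And>x y. convergent (\<lambda>i. x i - y i) \<longleftrightarrow> convergent (\<lambda>p. \<theta> x p - \<theta> y p)"
    using assms(3) unfolding borel_reducible_def E_rel_def by blast
  obtain D :: "'a set" where D: "countable D" "is_subgroup D" "D \<subseteq> identity_component"
    "identity_component \<subseteq> closure D"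
    using countable_dense_subgroup[OF identity_component_subgroup] by blast
  obtain T z where "generic_reduction NG NH D \<theta> T z"
    by (rule generic_reduction_exists[OF NG NH D(2) D(1) \<theta> red])
  then interpret dense_generic_reduction NG NH D \<theta> T z
    using D by (intro dense_generic_reduction.intro dense_generic_reduction_axioms.intro)
  obtain r S where "strict_mono r" "\<And>g. g \<in> D \<Longrightarrow> (\<lambda>n. \<Lambda> [(r n, g)]) \<longlonglongrightarrow> S g"
    by (rule \<Lambda>_subseq_limit) (rule that; assumption)
  then interpret limit_reduction NG NH D \<theta> T z r S
    by unfold_locales
  show ?thesis
    by (rule limit_homomorphism[OF identity_component_subgroup])
qed

end
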